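(* Let $5\le a<b<c<d\le n$ be four consecutive integers and $N'=[n]\setminus\{3,c\}$. Let $\Psi_{fo}:\mathbb{C}(\widehat{\mathrm{Gr}}_{3,N'})\to\mathbb{C}(\widehat{\mathrm{Gr}}_{3,n})$ be the forest promotion, induced by $$z_2\mapsto\frac{(z_1\wedge z_2)*(z_3\wedge z_4)}{\langle134\rangle}=z_2-\frac{\langle234\rangle}{\langle134\rangle}z_1,\qquad z_b\mapsto\frac{(z_a\wedge z_b)*(z_c\wedge z_d)}{\langle acd\rangle}=z_b-\frac{\langle bcd\rangle}{\langle acd\rangle}z_a,$$ and $z_j\mapsto z_j$ for all other $j\in N'$. Then $\Psi_{fo}$ is a quasi-cluster homomorphism from $\mathcal{A}(\Sigma)$ to $\mathcal{A}(\overline{\Sigma})$, where $\Sigma$ is the rectangles seed for $\mathrm{Gr}_{3,N'}$ and $\overline{\Sigma}$ is obtained from the rectangles seed $\tilde\Sigma$ for $\mathrm{Gr}_{3,n}$ by mutating at $\langle1bc\rangle$, then at $\langle12b\rangle$, then at $\langle12c\rangle$, and then freezing the four variables $\langle134\rangle,\langle124\rangle,\langle acd\rangle,\langle abd\rangle$ of the resulting seed.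
   Context: $\mathbb{C}(\widehat{\mathrm{Gr}}_{3,N})$: rational functions in Plücker coordinates $\langle ijk\rangle=\det[z_iz_jz_k]$ of a $3\times|N|$ matrix with columns $z_i$. The shuffle $(z_1\wedge z_2)*(z_3\wedge z_4)$ in $\wedge\mathbb{C}^3$ equals $\langle134\rangle z_2-\langle234\rangle z_1$. Rectangles seed for $\mathrm{Gr}_{3,N}$, $N=\{a_1<\dots<a_M\}$: vertices $v_0$ (variable $\langle a_1a_2a_3\rangle$) and $(r,c)$, $1\le r\le3$, $4\le c\le M$, with variables $\langle a_1a_2a_c\rangle$ ($r=1$), $\langle a_1a_{c-1}a_c\rangle$ ($r=2$), $\langle a_{c-2}a_{c-1}a_c\rangle$ ($r=3$). Frozen: $v_0$, row $3$, column $M$; mutable: $(r,c)$ with $r\le2$, $c\le M-1$. Arrows: $(r,c)\to(r,c+1)$, $(r,c)\to(r+1,c)$, $(r+1,c+1)\to(r,c)$ for $r\le2$, $c\le M-1$, and $v_0\to(1,4)$. Cluster algebras: seeds (cluster + quiver with mutable/frozen vertices); mutation $x_k'x_k=\prod_{i\to k}x_i+\prod_{k\to i}x_i$ with quiver mutation; $\mathcal{A}(\Sigma)$ generated by cluster variables over Laurent polynomials in frozen variables; $\mathbb{M}$ = Laurent monomials in frozen variables; exchange ratio $\hat y_\Sigma(x_i)=\prod_{i\to j}x_j/\prod_{j\to i}x_j$. A quasi-cluster homomorphism between cluster algebras of equal rank is an algebra homomorphism $f$ with $f(\mathbb{M})\subseteq\overline{\mathbb{M}}$ such that for some seeds $\Sigma,\overline{\Sigma}$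 and a bijection of mutable vertices $i\mapsto\bar i$, $f(x_i)\in\overline{\mathbb{M}}\,\bar x_{\bar i}$ and $f(\hat y_\Sigma(x_i))=\hat y_{\overline{\Sigma}}(\bar x_{\bar i})$. *)

theory Defs
  imports
    "HOL-Analysis.Determinants"
    "HOL-Library.Poly_Mapping"
    "HOL-Library.Product_Lexorder"
    "HOL-Computational_Algebra.Fraction_Field"
begin

section \<open>Rational functions on 3-row matrices\<close>

text \<open>
  The indeterminate \<^term>\<open>(j, r)\<close> is the entry in row \<^term>\<open>r\<close> of the column \<open>z\<^sub>j\<close>.  One field of
  rational functions, with a column for every natural number, is the ambient field of all
  \<open>\<complex>(Gr\<^sub>3\<^sub>,\<^sub>N)\<close>, so that these are subfields of it.  The linear order on
  \<^typ>\<open>nat \<times> 3\<close> is needed only for the \<open>idom\<close> instance of the polynomial ring.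
\<close>

type_synonym poly3 = "((nat \<times> 3) \<Rightarrow>\<^sub>0 nat) \<Rightarrow>\<^sub>0 complex"
type_synonym ratfun = "poly3 fract"

definition cst :: "complex \<Rightarrow> ratfun" where
  "cst a = Fract (Poly_Mapping.single 0 a) 1"

definition indet :: "nat \<times> 3 \<Rightarrow> ratfun" where
  "indet v = Fract (Poly_Mapping.single (Poly_Mapping.single v 1) 1) 1"

definition zvec :: "nat \<Rightarrow> ratfun ^ 3" where
  "zvec j = (\<chi> r. indet (j, r))"

definition det3 :: "ratfun ^ 3 \<Rightarrow> ratfun ^ 3 \<Rightarrow> ratfun ^ 3 \<Rightarrow> ratfun" where
  "det3 x y u = det (transpose (vector [x, y, u] :: ratfun ^ 3 ^ 3))"

definition pl :: "nat \<Rightarrow> nat \<Rightarrow> nat \<Rightarrow> ratfun" where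
  "pl i j k = det3 (zvec i) (zvec j) (zvec k)"

inductive_set gr_field :: "nat set \<Rightarrow> ratfun set" for N :: "nat set" where
  "cst a \<in> gr_field N"
| "i \<in> N \<Longrightarrow> j \<in> N \<Longrightarrow> k \<in> N \<Longrightarrow> pl i j k \<in> gr_field N"
| "f \<in> gr_field N \<Longrightarrow> g \<in> gr_field N \<Longrightarrow> f + g \<in> gr_field N"
| "f \<in> gr_field N \<Longrightarrow> g \<in> gr_field N \<Longrightarrow> f * g \<in> gr_field N"
| "f \<in> gr_field N \<Longrightarrow> inverse f \<in> gr_field N"

definition alg_hom_on :: "(ratfun \<Rightarrow> ratfun) \<Rightarrow> ratfun set \<Rightarrow> ratfun set \<Rightarrow> bool" where
  "alg_hom_on f A B \<longleftrightarrow>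
     f ` A \<subseteq> B \<and>
     (\<forall>a. f (cst a) = cst a) \<and>
     (\<forall>x\<in>A. \<forall>y\<in>A. f (x + y) = f x + f y) \<and>
     (\<forall>x\<in>A. \<forall>y\<in>A. f (x * y) = f x * f y)"


section \<open>Substitution into rational functions\<close>

definition poly_subst :: "(nat \<Rightarrow> ratfun ^ 3) \<Rightarrow> poly3 \<Rightarrow> ratfun" where
  "poly_subst w p =
     (\<Sum>m\<in>Poly_Mapping.keys p. cst (Poly_Mapping.lookup p m) *
        (\<Prod>(j, r)\<in>Poly_Mapping.keys m. (w j $ r) ^ Poly_Mapping.lookup m (j, r)))"

text \<open>
  The map on rational functions induced by \<open>z\<^sub>j \<mapsto> w j\<close>.  Its value at \<open>f\<close> is determined as soon as
  \<open>f\<close> can be written as \<open>p / q\<close> with a denominator that does not vanish under the substitution: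
  two such expressions give the same value.  Where no such expression exists, the value is
  unspecified.
\<close>

definition ratfun_subst :: "(nat \<Rightarrow> ratfun ^ 3) \<Rightarrow> ratfun \<Rightarrow> ratfun" where
  "ratfun_subst w f =
     (THE g. \<exists>p q. poly_subst w q \<noteq> 0 \<and> f = Fract p q \<and> g = poly_subst w p / poly_subst w q)"


section \<open>Forest promotion\<close>

text \<open>The shuffle \<open>(x \<and> y) * (u \<and> v)\<close>, which lies in the line where the planes \<open>\<langle>x, y\<rangle>\<close> and
  \<open>\<langle>u, v\<rangle>\<close> meet.\<close>

definition shuffle :: "ratfun ^ 3 \<Rightarrow> ratfun ^ 3 \<Rightarrow> ratfun ^ 3 \<Rightarrow> ratfun ^ 3 \<Rightarrow> ratfun ^ 3" where
  "shuffle x y u v = det3 x u v *s y - det3 y u v *s x"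

text \<open>The domain of interest is \<^term>\<open>gr_field ({1..n} - {3, c})\<close>, so the images of \<open>z\<^sub>3\<close> and \<open>z\<^sub>c\<close>
  play no role.\<close>

definition forest_promotion :: "nat \<Rightarrow> nat \<Rightarrow> nat \<Rightarrow> nat \<Rightarrow> ratfun \<Rightarrow> ratfun" where
  "forest_promotion a b c d =
     ratfun_subst (zvec(2 := inverse (pl 1 3 4) *s shuffle (zvec 1) (zvec 2) (zvec 3) (zvec 4),
                     b := inverse (pl a c d) *s shuffle (zvec a) (zvec b) (zvec c) (zvec d)))"


section \<open>Seeds and cluster algebras\<close>

text \<open>\<^term>\<open>arr S i j\<close> is the number of arrows \<open>i \<rightarrow> j\<close>; the frozen vertices are
  \<^term>\<open>verts S - mut S\<close>.\<close>

record 'v seed =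
  verts :: "'v set"
  mut :: "'v set"
  var :: "'v \<Rightarrow> ratfun"
  arr :: "'v \<Rightarrow> 'v \<Rightarrow> nat"

text \<open>Truncated subtraction on \<^typ>\<open>nat\<close> performs the cancellation of 2-cycles.\<close>

definition mutate :: "'v \<Rightarrow> 'v seed \<Rightarrow> 'v seed" where
  "mutate k S = S
     \<lparr> var := (var S)(k :=
         ((\<Prod>i\<in>verts S. var S i ^ arr S i k) + (\<Prod>i\<in>verts S. var S i ^ arr S k i)) / var S k),
       arr := (\<lambda>i j. if i = k \<or> j = k then arr S j i
                     else (arr S i j + arr S i k * arr S k j) - (arr S j i + arr S j k * arr S k i)) \<rparr>"

definition mutate_at :: "ratfun \<Rightarrow> 'v seed \<Rightarrow> 'v seed" where
  "mutate_at x S = mutate (THE v. v \<in> mut S \<and> var S v = x) S"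

definition freeze :: "ratfun set \<Rightarrow> 'v seed \<Rightarrow> 'v seed" where
  "freeze X S = S \<lparr> mut := {v \<in> mut S. var S v \<notin> X} \<rparr>"

inductive_set seeds :: "'v seed \<Rightarrow> 'v seed set" for S :: "'v seed" where
  "S \<in> seeds S"
| "T \<in> seeds S \<Longrightarrow> k \<in> mut T \<Longrightarrow> mutate k T \<in> seeds S"

inductive_set cluster_algebra :: "'v seed \<Rightarrow> ratfun set" for S :: "'v seed" where
  "cst a \<in> cluster_algebra S"
| "v \<in> verts S - mut S \<Longrightarrow> var S v \<in> cluster_algebra S"
| "v \<in> verts S - mut S \<Longrightarrow> inverse (var S v) \<in> cluster_algebra S"
| "T \<in> seeds S \<Longrightarrow> v \<in> mut T \<Longrightarrow> var T v \<in> cluster_algebra S"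
| "f \<in> cluster_algebra S \<Longrightarrow> g \<in> cluster_algebra S \<Longrightarrow> f + g \<in> cluster_algebra S"
| "f \<in> cluster_algebra S \<Longrightarrow> g \<in> cluster_algebra S \<Longrightarrow> f * g \<in> cluster_algebra S"

definition frozen_monomials :: "'v seed \<Rightarrow> ratfun set" where
  "frozen_monomials S = {\<Prod>v\<in>verts S - mut S. var S v powi e v | e :: 'v \<Rightarrow> int. True}"

definition yhat :: "'v seed \<Rightarrow> 'v \<Rightarrow> ratfun" where
  "yhat S i = (\<Prod>j\<in>verts S. var S j ^ arr S i j) / (\<Prod>j\<in>verts S. var S j ^ arr S j i)"

text \<open>
  The map \<open>f\<close> is a function on the ambient field, so that it can be applied to the exchange ratios,
  which are fractions of elements of the cluster algebra; this is meaningful for \<open>f\<close> that is a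
  homomorphism on a subfield containing the cluster algebra.
\<close>

definition quasi_cluster_hom :: "(ratfun \<Rightarrow> ratfun) \<Rightarrow> 'v seed \<Rightarrow> 'w seed \<Rightarrow> bool" where
  "quasi_cluster_hom f S S' \<longleftrightarrow>
     card (mut S) = card (mut S') \<and>
     alg_hom_on f (cluster_algebra S) (cluster_algebra S') \<and>
     f ` frozen_monomials S \<subseteq> frozen_monomials S' \<and>
     (\<exists>T\<in>seeds S. \<exists>T'\<in>seeds S'. \<exists>\<beta>. bij_betw \<beta> (mut T) (mut T') \<and>
        (\<forall>i\<in>mut T. (\<exists>m\<in>frozen_monomials S'. f (var T i) = m * var T' (\<beta> i)) \<and>
                    f (yhat T i) = yhat T' (\<beta> i)))"


section \<open>The rectangles seed\<close>

datatype vertex = V0 | V nat nat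

definition nth_elem :: "nat set \<Rightarrow> nat \<Rightarrow> nat" where
  "nth_elem N i = sorted_list_of_set N ! (i - 1)"

fun rect_var :: "nat set \<Rightarrow> vertex \<Rightarrow> ratfun" where
  "rect_var N V0 = pl (nth_elem N 1) (nth_elem N 2) (nth_elem N 3)"
| "rect_var N (V r c) =
     (if r = 1 then pl (nth_elem N 1) (nth_elem N 2) (nth_elem N c)
      else if r = 2 then pl (nth_elem N 1) (nth_elem N (c - 1)) (nth_elem N c)
      else pl (nth_elem N (c - 2)) (nth_elem N (c - 1)) (nth_elem N c))"

definition rect_arrows :: "nat \<Rightarrow> (vertex \<times> vertex) set" where
  "rect_arrows M =
     {(V0, V 1 4)} \<union>
     (\<Union>r\<in>{1..2}. \<Union>c\<in>{4..M - 1}.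
        {(V r c, V r (c + 1)), (V r c, V (r + 1) c), (V (r + 1) (c + 1), V r c)})"

definition rectangles_seed :: "nat set \<Rightarrow> vertex seed" where
  "rectangles_seed N =
     \<lparr> verts = {V0} \<union> {V r c | r c. r \<in> {1..3} \<and> c \<in> {4..card N}},
       mut = {V r c | r c. r \<in> {1..2} \<and> c \<in> {4..card N - 1}},
       var = rect_var N,
       arr = (\<lambda>u v. of_bool ((u, v) \<in> rect_arrows (card N))) \<rparr>"

end

theory Submission
  imports Defs
begin

text \<open>
  The substitution has a left inverse \<open>z\<^sub>3 \<mapsto> z\<^sub>2\<close>, \<open>z\<^sub>c \<mapsto> z\<^sub>b\<close> on the columns in \<open>[n] - {3, c}\<close>; hence it
  is injective there and extends to the field of fractions.  A quasi-cluster homomorphism may be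
  checked on one pair of seeds: exchange ratios mutate by a formula that involves only exchange
  ratios and arrows between mutable vertices, so the conditions propagate along simultaneous
  mutations and also show that cluster variables are sent to cluster variables up to frozen
  monomials.  For the initial pair, three mutations of the rectangles seed produce
  \<open>Q = \<langle>12b\<rangle>\<langle>acd\<rangle> - \<langle>12a\<rangle>\<langle>bcd\<rangle>\<close>, \<open>\<langle>acd\<rangle>\<close> and \<open>\<langle>abd\<rangle>\<close>, and the promotion sends \<open>\<langle>12b\<rangle>\<close> to
  \<open>Q / \<langle>acd\<rangle>\<close>; the exchange ratios then agree by Pluecker relations.  No cluster variable vanishes,
  since all of them are positive at points of the moment curve.
\<close>

section \<open>Substitution as a homomorphism\<close>

text \<open>The four variables to be frozen are dictated by the map. In the smaller seed
  \<open>pl 1 2 4\<close> sits at \<open>V0\<close> and \<open>pl a b d\<close> is a consecutive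
  triple of \<open>{1..n} - {3, c}\<close>; both are frozen there and fixed by the promotion, so
  they must be units of the target. The other two, \<open>pl a c d\<close> and
  \<open>pl 1 3 4\<close>, are denominators in the images of \<open>pl 1 2 b\<close> and
  \<open>pl 2 4 5\<close>. Column 4 of the large rectangles seed already contains
  \<open>pl 1 2 4\<close> and \<open>pl 1 3 4\<close>; the mutations supply the remaining two, and
  freezing leaves 2(n - 6) mutable vertices on either side. The obstacle is that the cluster algebra
  is generated by the variables of all seeds, while division is total with value 0 at 0. The
  mutation rule for exchange ratios therefore needs nonzero variables and nonzero exchange binomials
  along every mutation sequence. Only the source carries a set of positive elements; the target
  inherits nonvanishing, since the image of an invertible element is invertible.\<close>

lemma cst_0 [simp]: "cst 0 = 0"
  by (simp add: cst_def fract_collapse)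

lemma cst_1 [simp]: "cst 1 = 1"
  by (simp add: cst_def fract_collapse)

lemma cst_add: "cst (x + y) = cst x + cst y"
  by (simp add: cst_def single_add)

lemma cst_mult: "cst (x * y) = cst x * cst y"
  by (simp add: cst_def mult_single)

lemma cst_uminus: "cst (- x) = - cst x"
  using cst_add[of x "- x"] by (simp add: eq_neg_iff_add_eq_0 add.commute)

lemma cst_diff: "cst (x - y) = cst x - cst y"
  using cst_add[of x "- y"] by (simp add: cst_uminus)

lemma cst_eq_0_iff [simp]: "cst x = 0 \<longleftrightarrow> x = 0"
proof
  assume "cst x = 0"
  hence "Poly_Mapping.single (0 :: (nat \<times> 3) \<Rightarrow>\<^sub>0 nat) x = 0"
    by (simp add: cst_def Zero_fract_def eq_fract)
  thus "x = 0"
    by (metis lookup_single_eq lookup_zero)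
qed simp

lemma cst_inverse: "cst (inverse x) = inverse (cst x)"
proof (cases "x = 0")
  case False
  hence "cst x * cst (inverse x) = 1"
    by (simp flip: cst_mult)
  thus ?thesis
    by (metis inverse_unique)
qed simp

definition monom_subst :: "(nat \<Rightarrow> ratfun ^ 3) \<Rightarrow> ((nat \<times> 3) \<Rightarrow>\<^sub>0 nat) \<Rightarrow> ratfun" where
  "monom_subst w m =
     (\<Prod>v\<in>Poly_Mapping.keys m. (w (fst v) $ snd v) ^ Poly_Mapping.lookup m v)"

lemma monom_subst_superset:
  assumes "finite F" "Poly_Mapping.keys m \<subseteq> F"
  shows "monom_subst w m = (\<Prod>v\<in>F. (w (fst v) $ snd v) ^ Poly_Mapping.lookup m v)"
  unfolding monom_subst_def using assms
  by (intro prod.mono_neutral_left) (auto simp: in_keys_iff)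

lemma monom_subst_0 [simp]: "monom_subst w 0 = 1"
  by (simp add: monom_subst_def)

lemma monom_subst_single [simp]: "monom_subst w (Poly_Mapping.single v (Suc 0)) = w (fst v) $ snd v"
  by (simp add: monom_subst_superset[of "{v}"])

lemma monom_subst_add: "monom_subst w (m + m') = monom_subst w m * monom_subst w m'"
proof -
  let ?F = "Poly_Mapping.keys m \<union> Poly_Mapping.keys m'"
  have "monom_subst w (m + m') =
      (\<Prod>v\<in>?F. (w (fst v) $ snd v) ^ Poly_Mapping.lookup (m + m') v)"
    by (rule monom_subst_superset) (auto simp: keys_add)
  also have "\<dots> = monom_subst w m * monom_subst w m'"
    by (simp add: monom_subst_superset[of ?F] lookup_add power_add prod.distrib)
  finally show ?thesis .
qed

lemma poly_subst_superset:
  assumes "finite F" "Poly_Mapping.keys p \<subseteq> F"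
  shows "poly_subst w p = (\<Sum>m\<in>F. cst (Poly_Mapping.lookup p m) * monom_subst w m)"
proof -
  have "poly_subst w p =
      (\<Sum>m\<in>Poly_Mapping.keys p. cst (Poly_Mapping.lookup p m) * monom_subst w m)"
    by (simp add: poly_subst_def monom_subst_def case_prod_beta)
  also have "\<dots> = (\<Sum>m\<in>F. cst (Poly_Mapping.lookup p m) * monom_subst w m)"
    using assms by (intro sum.mono_neutral_left) (auto simp: in_keys_iff)
  finally show ?thesis .
qed

lemma poly_subst_0 [simp]: "poly_subst w 0 = 0"
  by (simp add: poly_subst_def)

lemma poly_subst_single: "poly_subst w (Poly_Mapping.single m x) = cst x * monom_subst w m"
  by (simp add: poly_subst_superset[of "{m}"])

lemma poly_subst_1 [simp]: "poly_subst w 1 = 1"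
  by (simp add: poly_subst_single flip: single_one)

lemma poly_subst_add: "poly_subst w (p + q) = poly_subst w p + poly_subst w q"
proof -
  let ?F = "Poly_Mapping.keys p \<union> Poly_Mapping.keys q"
  have "poly_subst w (p + q) =
      (\<Sum>m\<in>?F. cst (Poly_Mapping.lookup (p + q) m) * monom_subst w m)"
    by (rule poly_subst_superset) (auto simp: keys_add)
  also have "\<dots> = poly_subst w p + poly_subst w q"
    by (simp add: poly_subst_superset[of ?F] lookup_add cst_add sum.distrib algebra_simps)
  finally show ?thesis .
qed

text \<open>Subtracting one term lowers the number of keys by one. With this induction,
  multiplicativity of substitution reduces to products of two monomials, and the convolution product
  is never unfolded.\<close>

lemma poly_mapping_single_add_induct:
  assumes "P 0" and "\<And>m x p. P p \<Longrightarrow> P (Poly_Mapping.single m x + p)"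
  shows "P (p :: 'a \<Rightarrow>\<^sub>0 'b :: ab_group_add)"
proof (induction "card (Poly_Mapping.keys p)" arbitrary: p)
  case 0
  thus ?case
    using assms(1) by simp
next
  case (Suc k)
  then obtain m where m: "m \<in> Poly_Mapping.keys p"
    by fastforce
  define q where "q = p - Poly_Mapping.single m (Poly_Mapping.lookup p m)"
  have "Poly_Mapping.keys q = Poly_Mapping.keys p - {m}"
    by (auto simp: q_def in_keys_iff lookup_minus lookup_single when_def split: if_splits)
  hence "card (Poly_Mapping.keys q) = k"
    using Suc.hyps(2) m by simp
  moreover have "p = Poly_Mapping.single m (Poly_Mapping.lookup p m) + q"
    by (simp add: q_def)
  ultimately show ?case
    using Suc.hyps(1) assms(2) by metis
qed

lemma poly_subst_mult: "poly_subst w (p * q) = poly_subst w p * poly_subst w q"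
proof (induction p rule: poly_mapping_single_add_induct)
  case (2 m x p)
  have "poly_subst w (Poly_Mapping.single m x * q) = cst x * monom_subst w m * poly_subst w q"
  proof (induction q rule: poly_mapping_single_add_induct)
    case (2 m' y q)
    thus ?case
      by (simp add: distrib_left poly_subst_add mult_single poly_subst_single monom_subst_add
          cst_mult)
  qed simp
  with 2 show ?case
    by (simp add: distrib_right poly_subst_add poly_subst_single)
qed simp

text \<open>The graph of the partial map behind \<open>ratfun_subst\<close>. Working with the
  relation lets definedness and value be propagated together; the \<open>THE\<close> is evaluated
  only at the end, by \<open>ratfun_subst_eq\<close>.\<close>

definition subst_to :: "(nat \<Rightarrow> ratfun ^ 3) \<Rightarrow> ratfun \<Rightarrow> ratfun \<Rightarrow> bool" where
  "subst_to w f g \<longleftrightarrow>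
     (\<exists>p q. poly_subst w q \<noteq> 0 \<and> f = Fract p q \<and> g = poly_subst w p / poly_subst w q)"

lemma subst_to_unique:
  assumes "subst_to w f g" "subst_to w f h"
  shows "g = h"
proof -
  obtain p q where pq: "poly_subst w q \<noteq> 0" "f = Fract p q" "g = poly_subst w p / poly_subst w q"
    using assms(1) by (auto simp: subst_to_def)
  obtain r s where rs: "poly_subst w s \<noteq> 0" "f = Fract r s" "h = poly_subst w r / poly_subst w s"
    using assms(2) by (auto simp: subst_to_def)
  have "q \<noteq> 0" "s \<noteq> 0"
    using pq(1) rs(1) by auto
  with pq(2) rs(2) have "p * s = r * q"
    by (simp add: eq_fract)
  hence "poly_subst w p * poly_subst w s = poly_subst w r * poly_subst w q"
    by (simp flip: poly_subst_mult)
  thus ?thesis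
    using pq rs by (simp add: frac_eq_eq)
qed

lemma ratfun_subst_eq: "subst_to w f g \<Longrightarrow> ratfun_subst w f = g"
  unfolding ratfun_subst_def using subst_to_unique
  by (intro the_equality) (auto simp flip: subst_to_def)

lemma subst_to_cst: "subst_to w (cst x) (cst x)"
  unfolding subst_to_def cst_def
  by (intro exI[of _ "Poly_Mapping.single 0 x"] exI[of _ 1])
    (simp add: poly_subst_single cst_def)

lemma subst_to_indet: "subst_to w (indet v) (w (fst v) $ snd v)"
  unfolding subst_to_def indet_def
  by (intro exI[of _ "Poly_Mapping.single (Poly_Mapping.single v 1) 1"] exI[of _ 1])
    (simp add: poly_subst_single del: single_one)

lemma subst_to_0: "subst_to w 0 0" and subst_to_1: "subst_to w 1 1"
  using subst_to_cst[of w 0] subst_to_cst[of w 1] by simp_all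

lemma subst_to_add:
  assumes "subst_to w f g" "subst_to w f' g'"
  shows "subst_to w (f + f') (g + g')"
proof -
  obtain p q where pq: "poly_subst w q \<noteq> 0" "f = Fract p q" "g = poly_subst w p / poly_subst w q"
    using assms(1) by (auto simp: subst_to_def)
  obtain r s where rs: "poly_subst w s \<noteq> 0" "f' = Fract r s" "g' = poly_subst w r / poly_subst w s"
    using assms(2) by (auto simp: subst_to_def)
  have "q \<noteq> 0" "s \<noteq> 0"
    using pq(1) rs(1) by auto
  thus ?thesis
    unfolding subst_to_def using pq rs
    by (intro exI[of _ "p * s + r * q"] exI[of _ "q * s"])
      (simp add: poly_subst_mult poly_subst_add add_frac_eq)
qed

lemma subst_to_mult:
  assumes "subst_to w f g" "subst_to w f' g'"
  shows "subst_to w (f * f') (g * g')"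
proof -
  obtain p q where pq: "poly_subst w q \<noteq> 0" "f = Fract p q" "g = poly_subst w p / poly_subst w q"
    using assms(1) by (auto simp: subst_to_def)
  obtain r s where rs: "poly_subst w s \<noteq> 0" "f' = Fract r s" "g' = poly_subst w r / poly_subst w s"
    using assms(2) by (auto simp: subst_to_def)
  show ?thesis
    unfolding subst_to_def using pq rs
    by (intro exI[of _ "p * r"] exI[of _ "q * s"]) (simp add: poly_subst_mult)
qed

lemma subst_to_uminus: "subst_to w f g \<Longrightarrow> subst_to w (- f) (- g)"
  using subst_to_mult[OF subst_to_cst[of w "- 1"], of f g] by (simp add: cst_uminus)

lemma subst_to_diff: "subst_to w f g \<Longrightarrow> subst_to w f' g' \<Longrightarrow> subst_to w (f - f') (g - g')"
  using subst_to_add[OF _ subst_to_uminus] by fastforce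

lemma subst_to_inverse:
  assumes "subst_to w f g" "g \<noteq> 0"
  shows "subst_to w (inverse f) (inverse g)"
proof -
  obtain p q where pq: "poly_subst w q \<noteq> 0" "f = Fract p q" "g = poly_subst w p / poly_subst w q"
    using assms(1) by (auto simp: subst_to_def)
  show ?thesis
    unfolding subst_to_def using pq assms(2)
    by (intro exI[of _ q] exI[of _ p]) auto
qed

text \<open>Zero can only go to zero, by uniqueness. Hence a single evaluation with nonzero value
  certifies that a rational function does not vanish.\<close>

lemma subst_to_nonzero: "subst_to w f g \<Longrightarrow> g \<noteq> 0 \<Longrightarrow> f \<noteq> 0"
  using subst_to_0 subst_to_unique by blast

definition vec_subst_to :: "(nat \<Rightarrow> ratfun ^ 3) \<Rightarrow> ratfun ^ 3 \<Rightarrow> ratfun ^ 3 \<Rightarrow> bool" where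
  "vec_subst_to w x y \<longleftrightarrow> (\<forall>r. subst_to w (x $ r) (y $ r))"

lemma det3_expand:
  "det3 x y u = x $ 1 * y $ 2 * u $ 3 + x $ 2 * y $ 3 * u $ 1 + x $ 3 * y $ 1 * u $ 2
     - x $ 1 * y $ 3 * u $ 2 - x $ 2 * y $ 1 * u $ 3 - x $ 3 * y $ 2 * u $ 1"
  unfolding det3_def det_3 transpose_def by (simp add: algebra_simps)

lemma vec_subst_to_zvec: "vec_subst_to w (zvec j) (w j)"
  using subst_to_indet[of w "(j, _)"] by (simp add: vec_subst_to_def zvec_def)

lemma vec_subst_to_scale:
  "subst_to w f g \<Longrightarrow> vec_subst_to w x y \<Longrightarrow> vec_subst_to w (f *s x) (g *s y)"
  by (simp add: vec_subst_to_def subst_to_mult)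

lemma vec_subst_to_diff:
  "vec_subst_to w x y \<Longrightarrow> vec_subst_to w x' y' \<Longrightarrow> vec_subst_to w (x - x') (y - y')"
  by (simp add: vec_subst_to_def subst_to_diff)

lemma subst_to_det3:
  assumes "vec_subst_to w x x'" "vec_subst_to w y y'" "vec_subst_to w u u'"
  shows "subst_to w (det3 x y u) (det3 x' y' u')"
  unfolding det3_expand using assms[unfolded vec_subst_to_def]
  by (intro subst_to_diff subst_to_add subst_to_mult) blast+

lemma vec_subst_to_shuffle:
  assumes "vec_subst_to w x x'" "vec_subst_to w y y'" "vec_subst_to w u u'" "vec_subst_to w v v'"
  shows "vec_subst_to w (shuffle x y u v) (shuffle x' y' u' v')"
  unfolding shuffle_def using assms
  by (intro vec_subst_to_diff vec_subst_to_scale subst_to_det3)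

lemma subst_to_pl: "subst_to w (pl i j k) (det3 (w i) (w j) (w k))"
  unfolding pl_def by (intro subst_to_det3 vec_subst_to_zvec)

section \<open>Pluecker coordinates\<close>

lemma det3_diff_scale:
  "det3 (x - f *s x') y u = det3 x y u - f * det3 x' y u"
  "det3 x (y - f *s y') u = det3 x y u - f * det3 x y' u"
  "det3 x y (u - f *s u') = det3 x y u - f * det3 x y u'"
  unfolding det3_expand by (simp_all add: algebra_simps)

lemma det3_same [simp]: "det3 x x y = 0" "det3 x y x = 0" "det3 y x x = 0"
  unfolding det3_expand by (simp_all add: algebra_simps)

lemma det3_swap:
  "det3 y x u = - det3 x y u" "det3 x u y = - det3 x y u"
  unfolding det3_expand by (simp_all add: algebra_simps)

lemma det3_pluecker:
  "det3 p x y * det3 p u v - det3 p x u * det3 p y v + det3 p x v * det3 p y u = 0"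
  unfolding det3_expand by (simp add: algebra_simps)

lemma det3_rotate: "det3 x y u = det3 u x y"
  unfolding det3_expand by (simp add: algebra_simps)

text \<open>Four vectors \<open>p\<close>, \<open>q\<close>, \<open>r\<close>, \<open>s\<close> of a
  three-dimensional space satisfy Cramer's linear relation, with 3 by 3 minors as coefficients; the
  functional \<open>det3 x y\<close> is applied to it.\<close>

lemma det3_cramer:
  "det3 x y p * det3 q r s - det3 x y q * det3 p r s + det3 x y r * det3 p q s
     - det3 x y s * det3 p q r = 0"
proof -
  \<comment> \<open>The coordinates of the cross product of \<open>x\<close> and \<open>y\<close>.
    Treating them as atoms keeps the final polynomial identity small.\<close>
  define A where "A = x $ 2 * y $ 3 - x $ 3 * y $ 2"
  define B where "B = x $ 3 * y $ 1 - x $ 1 * y $ 3"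
  define C where "C = x $ 1 * y $ 2 - x $ 2 * y $ 1"
  have lin: "det3 x y u = u $ 1 * A + u $ 2 * B + u $ 3 * C" for u
    unfolding det3_expand A_def B_def C_def by (simp add: algebra_simps)
  show ?thesis
    unfolding lin unfolding det3_expand by (simp add: algebra_simps)
qed

text \<open>The shuffle \<open>det3 x p v *s y - det3 y p v *s x\<close> lies in the plane of
  \<open>p\<close> and \<open>v\<close>. Modulo \<open>v\<close> it is thus a multiple of
  \<open>p\<close>, and pairing with \<open>x\<close> and \<open>v\<close> shows that the factor is
  \<open>det3 x y v\<close>.\<close>

lemma det3_meet:
  "det3 y v u * det3 x p v - det3 y p v * det3 x v u = det3 x y v * det3 p v u"
  using det3_pluecker[of v x y u p] det3_rotate[of x p v] det3_rotate[of y p v]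
    det3_rotate[of x y v] det3_swap(1)[of v x u] det3_swap(1)[of v y u] det3_swap(1)[of v p u]
    det3_swap(2)[of v u p]
  by (simp add: algebra_simps)

lemma scale_diff_cancel:
  "(p :: 'a :: field) \<noteq> 0 \<Longrightarrow> inverse p *s (p *s x - q *s y) = x - (q / p) *s y"
  by (simp add: vec_eq_iff right_diff_distrib divide_inverse mult_ac)

section \<open>Mutation of seeds\<close>

abbreviation in_prod :: "'v seed \<Rightarrow> 'v \<Rightarrow> ratfun" where
  "in_prod S k \<equiv> (\<Prod>i\<in>verts S. var S i ^ arr S i k)"

abbreviation out_prod :: "'v seed \<Rightarrow> 'v \<Rightarrow> ratfun" where
  "out_prod S k \<equiv> (\<Prod>i\<in>verts S. var S i ^ arr S k i)"

lemma mutate_simps [simp]: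
  "verts (mutate k S) = verts S"
  "mut (mutate k S) = mut S"
  "var (mutate k S) = (var S)(k := (in_prod S k + out_prod S k) / var S k)"
  by (simp_all add: mutate_def)

lemma arr_mutate:
  "arr (mutate k S) i j = (if i = k \<or> j = k then arr S j i
     else (arr S i j + arr S i k * arr S k j) - (arr S j i + arr S j k * arr S k i))"
  by (simp add: mutate_def)

text \<open>The case \<open>i = j\<close> is included, so loops are excluded as well.\<close>

definition two_acyclic :: "'v seed \<Rightarrow> bool" where
  "two_acyclic S \<longleftrightarrow> (\<forall>i j. arr S i j = 0 \<or> arr S j i = 0)"

lemma two_acyclic_mutate: "two_acyclic S \<Longrightarrow> two_acyclic (mutate k S)"
  unfolding two_acyclic_def by (auto simp: arr_mutate)

lemma two_acyclic_loop [simp]: "two_acyclic S \<Longrightarrow> arr S i i = 0"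
  unfolding two_acyclic_def by blast

text \<open>At most one of the truncated differences is nonzero. This is why cancelling 2-cycles
  does not affect exchange ratios.\<close>

lemma power_diff_quotient:
  "(x :: 'a :: field) \<noteq> 0 \<Longrightarrow> x ^ (m - n) / x ^ (n - m) = x ^ m / x ^ n"
  by (cases "m \<le> n") (simp_all add: power_diff divide_simps flip: power_add)

lemma yhat_mutate_self:
  assumes "finite (verts S)" "arr S k k = 0"
  shows "yhat (mutate k S) k = inverse (yhat S k)"
proof -
  have "(\<Prod>j\<in>verts S. var (mutate k S) j ^ arr S j k) = in_prod S k"
    "(\<Prod>j\<in>verts S. var (mutate k S) j ^ arr S k j) = out_prod S k"
    using assms(2) by (auto intro!: prod.cong)
  thus ?thesis
    by (simp add: yhat_def arr_mutate del: mutate_simps(3))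
qed

text \<open>The new variable enters through the reversed arrows between \<open>i\<close> and
  \<open>k\<close>. Composite arrows through \<open>k\<close> contribute powers of the two products
  at \<open>k\<close>, and the powers of the old variable cancel.\<close>

lemma yhat_mutate:
  assumes "finite (verts S)" "\<forall>v\<in>verts S. var S v \<noteq> 0" "k \<in> verts S" "arr S k k = 0"
    "in_prod S k + out_prod S k \<noteq> 0" "i \<noteq> k"
  shows "yhat (mutate k S) i =
    yhat S i * (yhat S k / (1 + yhat S k)) ^ arr S i k * (1 + yhat S k) ^ arr S k i"
proof -
  define x where "x = var S"
  define W where "W = verts S - {k}"
  define x' where "x' = (in_prod S k + out_prod S k) / x k"
  \<comment> \<open>\<open>p\<close> and \<open>q\<close> count arrows before 2-cycles are
    cancelled; \<open>p j - q j\<close> and \<open>q j - p j\<close> are the arrow numbers after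
    mutation.\<close>
  define p where "p j = arr S i j + arr S i k * arr S k j" for j
  define q where "q j = arr S j i + arr S j k * arr S k i" for j
  have W: "finite W" "verts S = insert k W" "k \<notin> W"
    using assms by (auto simp: W_def)
  have nz: "x j \<noteq> 0" if "j \<in> W" for j
    using that assms(2) by (simp add: W_def x_def)
  have xk: "x k \<noteq> 0" "x' \<noteq> 0"
    using assms(2,3,5) by (auto simp: x_def x'_def)
  have yS: "yhat S j = out_prod S j / in_prod S j" for j
    by (simp add: yhat_def)
  have in_nz: "in_prod S k \<noteq> 0" and out_nz: "out_prod S k \<noteq> 0"
    using assms(1,2) by auto
  have k1: "in_prod S k = (\<Prod>j\<in>W. x j ^ arr S j k)" "out_prod S k = (\<Prod>j\<in>W. x j ^ arr S k j)"
    using W assms(4) by (simp_all add: x_def)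
  have i1: "in_prod S i = x k ^ arr S k i * (\<Prod>j\<in>W. x j ^ arr S j i)"
    "out_prod S i = x k ^ arr S i k * (\<Prod>j\<in>W. x j ^ arr S i j)"
    using W by (simp_all add: x_def)
  have num: "(\<Prod>j\<in>W. x j ^ p j) = (\<Prod>j\<in>W. x j ^ arr S i j) * out_prod S k ^ arr S i k"
    unfolding k1 p_def
    by (simp add: power_add prod.distrib prod_power_distrib mult.commute flip: power_mult)
  have den: "(\<Prod>j\<in>W. x j ^ q j) = (\<Prod>j\<in>W. x j ^ arr S j i) * in_prod S k ^ arr S k i"
    unfolding k1 q_def
    by (simp add: power_add prod.distrib prod_power_distrib mult.commute flip: power_mult)
  have "yhat (mutate k S) i =
      (x' ^ arr S k i * (\<Prod>j\<in>W. x j ^ (p j - q j))) / (x' ^ arr S i k * (\<Prod>j\<in>W. x j ^ (q j - p j)))"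
  proof -
    have "(\<Prod>j\<in>W. var (mutate k S) j ^ arr (mutate k S) i j) = (\<Prod>j\<in>W. x j ^ (p j - q j))"
      "(\<Prod>j\<in>W. var (mutate k S) j ^ arr (mutate k S) j i) = (\<Prod>j\<in>W. x j ^ (q j - p j))"
      using W assms(6) by (auto intro!: prod.cong simp: arr_mutate p_def q_def x_def)
    moreover have "var (mutate k S) k = x'"
      by (simp add: x'_def x_def)
    moreover have "arr (mutate k S) i k = arr S k i" "arr (mutate k S) k i = arr S i k"
      by (simp_all add: arr_mutate)
    ultimately show ?thesis
      unfolding yhat_def using W by (simp del: mutate_simps(3))
  qed
  also have "\<dots> = x' ^ arr S k i / x' ^ arr S i k *
      ((\<Prod>j\<in>W. x j ^ (p j - q j)) / (\<Prod>j\<in>W. x j ^ (q j - p j)))"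
    by simp
  also have "(\<Prod>j\<in>W. x j ^ (p j - q j)) / (\<Prod>j\<in>W. x j ^ (q j - p j)) =
      (\<Prod>j\<in>W. x j ^ p j) / (\<Prod>j\<in>W. x j ^ q j)"
    unfolding prod_dividef[symmetric] using nz by (intro prod.cong) (auto simp: power_diff_quotient)
  also have "x' ^ arr S k i / x' ^ arr S i k * \<dots> =
      yhat S i * (out_prod S k / (in_prod S k + out_prod S k)) ^ arr S i k
        * ((in_prod S k + out_prod S k) / in_prod S k) ^ arr S k i"
    unfolding num den yS i1 x'_def using xk in_nz out_nz assms(5)
    by (simp add: power_divide divide_simps)
  also have "out_prod S k / (in_prod S k + out_prod S k) = yhat S k / (1 + yhat S k)"
    unfolding yS using in_nz by (simp add: divide_simps)
  also have "(in_prod S k + out_prod S k) / in_prod S k = 1 + yhat S k"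
    unfolding yS using in_nz by (simp add: divide_simps)
  finally show ?thesis .
qed

lemma yhat_as_prods: "yhat S i = out_prod S i / in_prod S i"
  by (simp add: yhat_def)

text \<open>Here the exchange binomial appears as a whole, so that in the explicit mutations below a
  Pluecker relation can replace it by a product.\<close>

lemma yhat_mutate_prods:
  assumes "finite (verts S)" "\<forall>v\<in>verts S. var S v \<noteq> 0" "k \<in> verts S" "arr S k k = 0"
    "in_prod S k + out_prod S k \<noteq> 0" "i \<noteq> k"
  shows "yhat (mutate k S) i = yhat S i *
    (out_prod S k / (in_prod S k + out_prod S k)) ^ arr S i k *
    ((in_prod S k + out_prod S k) / in_prod S k) ^ arr S k i"
proof -
  have "in_prod S k \<noteq> 0"
    using assms(1,2) by auto
  hence "yhat S k / (1 + yhat S k) = out_prod S k / (in_prod S k + out_prod S k)"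
    "1 + yhat S k = (in_prod S k + out_prod S k) / in_prod S k"
    by (simp_all add: yhat_as_prods divide_simps)
  thus ?thesis
    unfolding yhat_mutate[OF assms] by (simp only:)
qed

section \<open>The group of frozen monomials\<close>

lemma frozen_monomials_1: "1 \<in> frozen_monomials S"
  unfolding frozen_monomials_def by (auto intro!: exI[of _ "\<lambda>_. 0"])

lemma frozen_monomials_mult:
  assumes "\<forall>v\<in>verts S - mut S. var S v \<noteq> 0" "x \<in> frozen_monomials S" "y \<in> frozen_monomials S"
  shows "x * y \<in> frozen_monomials S"
proof -
  obtain e e' where
    "x = (\<Prod>v\<in>verts S - mut S. var S v powi e v)" "y = (\<Prod>v\<in>verts S - mut S. var S v powi e' v)"
    using assms(2,3) unfolding frozen_monomials_def by blast
  hence "x * y = (\<Prod>v\<in>verts S - mut S. var S v powi (e v + e' v))"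
    using assms(1) by (simp add: power_int_add flip: prod.distrib)
  thus ?thesis
    unfolding frozen_monomials_def by (auto intro!: exI[of _ "\<lambda>v. e v + e' v"])
qed

lemma frozen_monomials_inverse:
  assumes "x \<in> frozen_monomials S"
  shows "inverse x \<in> frozen_monomials S"
proof -
  obtain e where "x = (\<Prod>v\<in>verts S - mut S. var S v powi e v)"
    using assms unfolding frozen_monomials_def by blast
  hence "inverse x = (\<Prod>v\<in>verts S - mut S. var S v powi (- e v))"
    by (simp add: power_int_minus flip: prod_inversef)
  thus ?thesis
    unfolding frozen_monomials_def by (auto intro!: exI[of _ "\<lambda>v. - e v"])
qed

lemma frozen_monomials_nonzero:
  assumes "\<forall>v\<in>verts S - mut S. var S v \<noteq> 0" "finite (verts S)" "x \<in> frozen_monomials S"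
  shows "x \<noteq> 0"
  using assms unfolding frozen_monomials_def by auto

lemma frozen_monomials_var:
  assumes "finite (verts S)" "v \<in> verts S - mut S"
  shows "var S v \<in> frozen_monomials S"
proof -
  have "var S v = (\<Prod>u\<in>verts S - mut S. var S u powi (if u = v then 1 else 0))"
    using assms by (subst prod.remove[of _ v]) (auto intro!: prod.neutral[symmetric])
  thus ?thesis
    unfolding frozen_monomials_def by (auto intro!: exI[of _ "\<lambda>u. if u = v then 1 else 0"])
qed

lemma frozen_monomials_power:
  assumes "\<forall>v\<in>verts S - mut S. var S v \<noteq> 0" "x \<in> frozen_monomials S"
  shows "x ^ n \<in> frozen_monomials S"
  by (induction n) (simp_all add: frozen_monomials_1 frozen_monomials_mult[OF assms(1)] assms(2))

lemma frozen_monomials_power_int: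
  assumes "\<forall>v\<in>verts S - mut S. var S v \<noteq> 0" "x \<in> frozen_monomials S"
  shows "x powi n \<in> frozen_monomials S"
  by (simp add: power_int_def frozen_monomials_power[OF assms(1)] frozen_monomials_inverse assms(2))

lemma frozen_monomials_prod:
  assumes "\<forall>v\<in>verts S - mut S. var S v \<noteq> 0" "\<And>i. i \<in> A \<Longrightarrow> x i \<in> frozen_monomials S"
  shows "(\<Prod>i\<in>A. x i) \<in> frozen_monomials S"
  using assms(2)
  by (induction A rule: infinite_finite_induct)
    (simp_all add: frozen_monomials_1 frozen_monomials_mult[OF assms(1)])

lemma frozen_monomials_mutate [simp]:
  "k \<in> mut S \<Longrightarrow> frozen_monomials (mutate k S) = frozen_monomials S"
  unfolding frozen_monomials_def
  by (intro Collect_cong ex_cong1 conj_cong arg_cong2[where f = "(=)"] prod.cong) auto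

lemma cluster_algebra_prod:
  assumes "\<And>i. i \<in> A \<Longrightarrow> x i \<in> cluster_algebra S"
  shows "(\<Prod>i\<in>A. x i) \<in> cluster_algebra S"
  using assms cluster_algebra.intros(1)[of 1 S]
  by (induction A rule: infinite_finite_induct) (auto intro: cluster_algebra.intros(6))

lemma cluster_algebra_power: "x \<in> cluster_algebra S \<Longrightarrow> x ^ n \<in> cluster_algebra S"
  using cluster_algebra.intros(1)[of 1 S] by (induction n) (auto intro: cluster_algebra.intros(6))

lemma frozen_monomials_subset_cluster_algebra: "frozen_monomials S \<subseteq> cluster_algebra S"
  unfolding frozen_monomials_def power_int_def
  by (auto intro!: cluster_algebra_prod cluster_algebra_power intro: cluster_algebra.intros(2,3))

section \<open>Quasi-cluster homomorphisms from one pair of seeds\<close>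

text \<open>The subset \<open>P\<close> of the field \<open>K\<close> stands for a set of positive elements; it serves to exclude
  vanishing cluster variables.\<close>

locale positive_field_hom =
  fixes f :: "ratfun \<Rightarrow> ratfun" and K P :: "ratfun set"
  assumes K_cst: "cst a \<in> K"
    and K_add: "x \<in> K \<Longrightarrow> y \<in> K \<Longrightarrow> x + y \<in> K"
    and K_mult: "x \<in> K \<Longrightarrow> y \<in> K \<Longrightarrow> x * y \<in> K"
    and K_inverse: "x \<in> K \<Longrightarrow> inverse x \<in> K"
    and f_cst: "f (cst a) = cst a"
    and f_add: "x \<in> K \<Longrightarrow> y \<in> K \<Longrightarrow> f (x + y) = f x + f y"
    and f_mult: "x \<in> K \<Longrightarrow> y \<in> K \<Longrightarrow> f (x * y) = f x * f y"
    and P_1: "1 \<in> P"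
    and P_add: "x \<in> P \<Longrightarrow> y \<in> P \<Longrightarrow> x + y \<in> P"
    and P_mult: "x \<in> P \<Longrightarrow> y \<in> P \<Longrightarrow> x * y \<in> P"
    and P_inverse: "x \<in> P \<Longrightarrow> inverse x \<in> P"
    and P_nonzero: "0 \<notin> P"
    and P_subset: "P \<subseteq> K"
begin

lemma f_1: "f 1 = 1" and f_0: "f 0 = 0"
  using f_cst[of 1] f_cst[of 0] by simp_all

lemma f_inverse:
  assumes "x \<in> K"
  shows "f (inverse x) = inverse (f x)"
proof (cases "x = 0")
  case False
  hence "f x * f (inverse x) = 1"
    using f_mult[OF assms K_inverse[OF assms]] by (simp add: f_1)
  thus ?thesis
    by (metis inverse_unique)
qed (simp add: f_0)

lemma f_divide: "x \<in> K \<Longrightarrow> y \<in> K \<Longrightarrow> f (x / y) = f x / f y"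
  by (simp add: divide_inverse f_mult f_inverse K_inverse)

lemma P_divide: "x \<in> P \<Longrightarrow> y \<in> P \<Longrightarrow> x / y \<in> P"
  by (simp add: divide_inverse P_mult P_inverse)

text \<open>The product of \<open>f x\<close> and \<open>f (inverse x)\<close> is 1. No positivity
  on the target side is involved.\<close>

lemma f_nonzero: "x \<in> P \<Longrightarrow> f x \<noteq> 0"
  using f_mult[of x "inverse x"] P_subset P_nonzero K_inverse
  by (metis f_1 mult_zero_left right_inverse subsetD zero_neq_one)

lemma P_power: "x \<in> P \<Longrightarrow> x ^ n \<in> P"
  by (induction n) (auto simp: P_1 P_mult)

lemma P_prod: "(\<And>i. i \<in> A \<Longrightarrow> g i \<in> P) \<Longrightarrow> (\<Prod>i\<in>A. g i) \<in> P"
  by (induction A rule: infinite_finite_induct) (auto simp: P_1 P_mult)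

lemma f_power: "x \<in> P \<Longrightarrow> f (x ^ n) = f x ^ n"
  using P_subset by (induction n) (auto simp: f_1 f_mult P_power subset_iff)

lemma P_power_int: "x \<in> P \<Longrightarrow> x powi n \<in> P"
  by (simp add: power_int_def P_power P_inverse)

lemma f_power_int: "x \<in> P \<Longrightarrow> f (x powi n) = f x powi n"
  using P_subset
  by (auto simp: power_int_def f_power f_inverse[OF subsetD] P_inverse)

lemma f_prod: "(\<And>i. i \<in> A \<Longrightarrow> g i \<in> P) \<Longrightarrow> f (\<Prod>i\<in>A. g i) = (\<Prod>i\<in>A. f (g i))"
  using P_subset
  by (induction A rule: infinite_finite_induct) (auto simp: f_1 f_mult P_prod subset_iff)

text \<open>The invariant carried along simultaneous mutations. Agreement of arrows between mutable
  vertices makes the condition on exchange ratios survive a mutation. Nonvanishing in the target is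
  demanded of frozen variables only, because for mutable ones it follows by applying
  \<open>f\<close> to positive elements.\<close>

definition quasi_pair :: "('v \<Rightarrow> 'w) \<Rightarrow> 'v seed \<Rightarrow> 'w seed \<Rightarrow> bool" where
  "quasi_pair \<beta> T T' \<longleftrightarrow>
     finite (verts T) \<and> finite (verts T') \<and> mut T \<subseteq> verts T \<and> mut T' \<subseteq> verts T' \<and>
     two_acyclic T \<and> two_acyclic T' \<and>
     (\<forall>v\<in>verts T. var T v \<in> P) \<and>
     (\<forall>v\<in>verts T' - mut T'. var T' v \<noteq> 0) \<and>
     bij_betw \<beta> (mut T) (mut T') \<and>
     (\<forall>v\<in>verts T - mut T. f (var T v) \<in> frozen_monomials T') \<and>
     (\<forall>i\<in>mut T. \<exists>m\<in>frozen_monomials T'. f (var T i) = m * var T' (\<beta> i)) \<and>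
     (\<forall>i\<in>mut T. f (yhat T i) = yhat T' (\<beta> i)) \<and>
     (\<forall>i\<in>mut T. \<forall>j\<in>mut T. arr T i j = arr T' (\<beta> i) (\<beta> j))"

lemma quasi_pair_f_in_prod:
  assumes "quasi_pair \<beta> T T'" "k \<in> mut T"
  shows "\<exists>m\<in>frozen_monomials T'. f (in_prod T k) = m * in_prod T' (\<beta> k)"
proof -
  note q = assms(1)[unfolded quasi_pair_def]
  have fz: "\<forall>v\<in>verts T' - mut T'. var T' v \<noteq> 0"
    using q by blast
  obtain m where m: "m i \<in> frozen_monomials T'" "f (var T i) = m i * var T' (\<beta> i)"
    if "i \<in> mut T" for i
    using q by metis
  define A where "A = (\<Prod>i\<in>verts T - mut T. f (var T i) ^ arr T i k)"
  define B where "B = (\<Prod>i\<in>mut T. m i ^ arr T i k)"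
  define C where "C = (\<Prod>i\<in>verts T' - mut T'. var T' i ^ arr T' i (\<beta> k))"
  define X where "X = (\<Prod>i\<in>mut T. var T' (\<beta> i) ^ arr T' (\<beta> i) (\<beta> k))"
  have "f (in_prod T k) = (\<Prod>i\<in>verts T. f (var T i) ^ arr T i k)"
    using q by (subst f_prod) (auto intro!: prod.cong simp: f_power P_power)
  also have "\<dots> = A * (\<Prod>i\<in>mut T. f (var T i) ^ arr T i k)"
    unfolding A_def using q by (intro prod.subset_diff) auto
  also have "(\<Prod>i\<in>mut T. f (var T i) ^ arr T i k) = B * X"
    unfolding B_def X_def prod.distrib[symmetric] using q assms(2)
    by (intro prod.cong) (auto simp: m(2) power_mult_distrib)
  finally have 1: "f (in_prod T k) = A * (B * X)" .
  have "in_prod T' (\<beta> k) = C * (\<Prod>i\<in>mut T'. var T' i ^ arr T' i (\<beta> k))"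
    unfolding C_def using q by (intro prod.subset_diff) auto
  also have "(\<Prod>i\<in>mut T'. var T' i ^ arr T' i (\<beta> k)) = X"
    unfolding X_def using q by (intro prod.reindex_bij_betw[symmetric]) auto
  finally have 2: "in_prod T' (\<beta> k) = C * X" .
  have C: "C \<in> frozen_monomials T'"
    unfolding C_def using q
    by (intro frozen_monomials_prod frozen_monomials_power frozen_monomials_var) auto
  moreover have "A \<in> frozen_monomials T'" "B \<in> frozen_monomials T'"
    unfolding A_def B_def using q m
    by (auto intro!: frozen_monomials_prod frozen_monomials_power)
  ultimately have "A * B * inverse C \<in> frozen_monomials T'"
    by (intro frozen_monomials_mult frozen_monomials_inverse fz)
  moreover have "C \<noteq> 0"
    using frozen_monomials_nonzero[OF fz _ C] q by blast
  hence "f (in_prod T k) = A * B * inverse C * in_prod T' (\<beta> k)"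
    unfolding 1 2 by (simp add: field_simps)
  ultimately show ?thesis
    by blast
qed

lemma quasi_pair_mutate:
  assumes "quasi_pair \<beta> T T'" "k \<in> mut T"
  shows "quasi_pair \<beta> (mutate k T) (mutate (\<beta> k) T')"
proof -
  note q = assms(1)[unfolded quasi_pair_def]
  let ?k = "\<beta> k"
  have fin: "finite (verts T)" "finite (verts T')" and sub: "mut T \<subseteq> verts T" "mut T' \<subseteq> verts T'"
    and ac: "two_acyclic T" "two_acyclic T'" and vP: "\<forall>v\<in>verts T. var T v \<in> P"
    and fz: "\<forall>v\<in>verts T' - mut T'. var T' v \<noteq> 0" and bij: "bij_betw \<beta> (mut T) (mut T')"
    and fr: "\<forall>v\<in>verts T - mut T. f (var T v) \<in> frozen_monomials T'"
    and fv: "\<forall>i\<in>mut T. \<exists>m\<in>frozen_monomials T'. f (var T i) = m * var T' (\<beta> i)"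
    and fy: "\<forall>i\<in>mut T. f (yhat T i) = yhat T' (\<beta> i)"
    and ar: "\<forall>i\<in>mut T. \<forall>j\<in>mut T. arr T i j = arr T' (\<beta> i) (\<beta> j)"
    using q by blast+
  have km: "?k \<in> mut T'" "k \<in> verts T" "?k \<in> verts T'"
    using bij assms(2) sub by (auto simp: bij_betw_def)
  have inj: "\<beta> i = \<beta> j \<longleftrightarrow> i = j" if "i \<in> mut T" "j \<in> mut T" for i j
    using bij that by (auto simp: bij_betw_def inj_on_def)
  have P_in: "in_prod T i \<in> P" and P_out: "out_prod T i \<in> P" for i
    using vP by (auto intro!: P_prod P_power)
  have P_y: "yhat T i \<in> P" for i
    unfolding yhat_def by (intro P_divide P_in P_out)
  have P_y1: "1 + yhat T i \<in> P" for i
    by (intro P_add P_1 P_y)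
  have nz: "\<forall>v\<in>verts T. var T v \<noteq> 0"
    using vP P_nonzero by auto
  \<comment> \<open>A mutable target variable divides the nonzero image of a positive source
    variable.\<close>
  have nz': "\<forall>v\<in>verts T'. var T' v \<noteq> 0"
  proof
    fix v assume v: "v \<in> verts T'"
    show "var T' v \<noteq> 0"
    proof (cases "v \<in> mut T'")
      case True
      then obtain i where i: "i \<in> mut T" "v = \<beta> i"
        using bij by (auto simp: bij_betw_def)
      then obtain m where "f (var T i) = m * var T' v"
        using fv by blast
      thus ?thesis
        using f_nonzero vP i(1) sub by (metis mult_zero_right subsetD)
    qed (use v fz in blast)
  qed
  have in_nz: "in_prod T k \<noteq> 0" "in_prod T' ?k \<noteq> 0"
    using nz nz' fin by auto
  have f1y: "f (1 + yhat T k) = 1 + yhat T' ?k"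
    using fy assms(2) P_1 P_y P_subset by (subst f_add) (auto simp: f_1)
  \<comment> \<open>This factorization separates a part known up to a frozen monomial from the
    factor \<open>1 + yhat T k\<close>, whose image is known exactly.\<close>
  have sum: "in_prod T k + out_prod T k = in_prod T k * (1 + yhat T k)"
    "in_prod T' ?k + out_prod T' ?k = in_prod T' ?k * (1 + yhat T' ?k)"
    using in_nz by (simp_all add: yhat_def field_simps)
  have sum_P: "in_prod T k + out_prod T k \<in> P"
    by (intro P_add P_in P_out)
  have y1_nz: "1 + yhat T' ?k \<noteq> 0"
    using f_nonzero[OF P_y1[of k]] f1y by simp
  have sum_nz: "in_prod T k + out_prod T k \<noteq> 0" "in_prod T' ?k + out_prod T' ?k \<noteq> 0"
    using sum_P P_nonzero in_nz y1_nz sum by auto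
  have vP': "\<forall>v\<in>verts T. var (mutate k T) v \<in> P"
    using vP sum_P km(2) by (auto intro: P_divide)
  have fv': "\<exists>m\<in>frozen_monomials T'. f (var (mutate k T) i) = m * var (mutate ?k T') (\<beta> i)"
    if i: "i \<in> mut T" for i
  proof (cases "i = k")
    case True
    obtain m where m: "m \<in> frozen_monomials T'" "f (in_prod T k) = m * in_prod T' ?k"
      using quasi_pair_f_in_prod[OF assms] by blast
    obtain m' where m': "m' \<in> frozen_monomials T'" "f (var T k) = m' * var T' ?k"
      using fv assms(2) by blast
    have K: "in_prod T k \<in> K" "1 + yhat T k \<in> K" "var T k \<in> K"
      using P_subset P_in P_y1 vP km(2) by blast+
    have "f (var (mutate k T) k) = f (in_prod T k * (1 + yhat T k) / var T k)"
      by (simp add: sum)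
    also have "\<dots> = f (in_prod T k) * f (1 + yhat T k) / f (var T k)"
      using K by (simp add: f_mult f_divide K_mult)
    also have "\<dots> = (m * inverse m') * var (mutate ?k T') ?k"
      by (simp add: sum m m' f1y divide_simps)
    finally show ?thesis
      using True frozen_monomials_mult[OF fz m(1) frozen_monomials_inverse[OF m'(1)]] by blast
  qed (use fv i inj assms(2) in auto)
  have fy': "f (yhat (mutate k T) i) = yhat (mutate ?k T') (\<beta> i)" if i: "i \<in> mut T" for i
  proof (cases "i = k")
    case True
    thus ?thesis
      using fin ac fy i f_inverse[OF subsetD[OF P_subset P_y]] by (simp add: yhat_mutate_self)
  next
    case False
    let ?r = "yhat T k / (1 + yhat T k)"
    have K: "yhat T i \<in> K" "?r ^ p \<in> K" "(1 + yhat T k) ^ p \<in> K" for p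
      by (intro subsetD[OF P_subset] P_power P_divide P_y P_y1)+
    have fr: "f (?r ^ p) = (yhat T' ?k / (1 + yhat T' ?k)) ^ p" for p
      using f1y fy assms(2) f_divide[OF subsetD[OF P_subset P_y] subsetD[OF P_subset P_y1]]
      by (simp add: f_power P_divide P_y P_y1)
    have fs: "f ((1 + yhat T k) ^ p) = (1 + yhat T' ?k) ^ p" for p
      by (simp add: f_power P_y1 f1y)
    have "f (yhat (mutate k T) i) = f (yhat T i * ?r ^ arr T i k * (1 + yhat T k) ^ arr T k i)"
      using fin ac nz km sum_nz False by (subst yhat_mutate) auto
    also have "\<dots> = yhat T' (\<beta> i) * (yhat T' ?k / (1 + yhat T' ?k)) ^ arr T i k
        * (1 + yhat T' ?k) ^ arr T k i"
      using K fy i by (simp add: f_mult K_mult fr fs)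
    also have "\<dots> = yhat (mutate ?k T') (\<beta> i)"
      using fin ac nz' km sum_nz False inj ar i assms(2) by (subst yhat_mutate) auto
    finally show ?thesis .
  qed
  have ar': "arr (mutate k T) i j = arr (mutate ?k T') (\<beta> i) (\<beta> j)"
    if "i \<in> mut T" "j \<in> mut T" for i j
    using that ar assms(2) inj by (simp add: arr_mutate)
  have fz': "var (mutate ?k T') v \<noteq> 0" if "v \<in> verts T' - mut T'" for v
    using that fz km(1) by auto
  have fr': "f (var (mutate k T) v) \<in> frozen_monomials T'" if "v \<in> verts T - mut T" for v
    using that fr assms(2) by auto
  show ?thesis
    unfolding quasi_pair_def mutate_simps(1,2) frozen_monomials_mutate[OF km(1)]
    by (intro conjI ballI fin sub two_acyclic_mutate ac bij vP'[rule_format] fv' fy' ar' fr' fz')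
qed

text \<open>Each mutation at \<open>k\<close> is answered by the mutation at the vertex
  corresponding to \<open>k\<close>. The correspondence and the group of frozen monomials stay the
  same throughout.\<close>

lemma quasi_pair_seeds:
  assumes "quasi_pair \<beta> S S'" "T \<in> seeds S"
  shows "\<exists>T'\<in>seeds S'. quasi_pair \<beta> T T' \<and> frozen_monomials T' = frozen_monomials S'"
  using assms(2)
proof induction
  case 1
  thus ?case
    using assms(1) seeds.intros(1) by blast
next
  case (2 T k)
  then obtain T' where T': "T' \<in> seeds S'" "quasi_pair \<beta> T T'"
      "frozen_monomials T' = frozen_monomials S'"
    by blast
  have k: "\<beta> k \<in> mut T'"
    using T'(2) 2(2) by (auto simp: quasi_pair_def bij_betw_def)
  show ?case
    using seeds.intros(2)[OF T'(1) k] quasi_pair_mutate[OF T'(2) 2(2)] T'(3) k by fastforce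
qed

text \<open>The existential part of the definition is met by the given pair. The pairs obtained by
  mutation serve the homomorphism part: every generator of the source algebra must land in the
  target algebra, and every cluster variable occurs in some matched seed.\<close>

theorem quasi_cluster_homI:
  assumes "quasi_pair \<beta> S S'"
  shows "quasi_cluster_hom f S S'"
proof -
  note q = assms[unfolded quasi_pair_def]
  have fz: "\<forall>v\<in>verts S' - mut S'. var S' v \<noteq> 0"
    using q by blast
  have fr: "f (var S v) \<in> frozen_monomials S'" and vP: "var S v \<in> P" if "v \<in> verts S - mut S" for v
    using q that by blast+
  have CA: "x \<in> K \<and> f x \<in> cluster_algebra S'" if "x \<in> cluster_algebra S" for x
    using that
  proof induction
    case (1 a)
    thus ?case by (simp add: K_cst f_cst cluster_algebra.intros(1))
  next
    case (2 v)
    thus ?case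
      using fr vP P_subset frozen_monomials_subset_cluster_algebra by blast
  next
    case (3 v)
    have K: "var S v \<in> K"
      using vP[OF 3] P_subset by blast
    have "inverse (f (var S v)) \<in> frozen_monomials S'"
      by (intro frozen_monomials_inverse fr 3)
    thus ?case
      using K frozen_monomials_subset_cluster_algebra by (auto simp: f_inverse K_inverse)
  next
    case (4 T v)
    obtain T' where T': "T' \<in> seeds S'" "quasi_pair \<beta> T T'" "frozen_monomials T' = frozen_monomials S'"
      using quasi_pair_seeds[OF assms 4(1)] by blast
    have "var T v \<in> P" and v: "\<beta> v \<in> mut T'"
      using T'(2) 4(2) by (auto simp: quasi_pair_def bij_betw_def)
    moreover obtain m where "m \<in> frozen_monomials S'" "f (var T v) = m * var T' (\<beta> v)"
      using T'(2,3) 4(2) by (auto simp: quasi_pair_def)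
    ultimately show ?case
      using P_subset frozen_monomials_subset_cluster_algebra[of S']
        cluster_algebra.intros(6)[OF _ cluster_algebra.intros(4)[OF T'(1) v]]
      by (simp add: subset_iff)
  next
    case (5 x y)
    thus ?case by (simp add: K_add f_add cluster_algebra.intros(5))
  next
    case (6 x y)
    thus ?case by (simp add: K_mult f_mult cluster_algebra.intros(6))
  qed
  have "f ` frozen_monomials S \<subseteq> frozen_monomials S'"
  proof
    fix y assume "y \<in> f ` frozen_monomials S"
    then obtain e where "y = f (\<Prod>v\<in>verts S - mut S. var S v powi e v)"
      unfolding frozen_monomials_def by blast
    also have "\<dots> = (\<Prod>v\<in>verts S - mut S. f (var S v) powi e v)"
      using vP by (subst f_prod) (simp_all add: P_power_int f_power_int)
    also have "\<dots> \<in> frozen_monomials S'"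
      using fr by (intro frozen_monomials_prod frozen_monomials_power_int fz)
    finally show "y \<in> frozen_monomials S'" .
  qed
  moreover have "alg_hom_on f (cluster_algebra S) (cluster_algebra S')"
    unfolding alg_hom_on_def using CA by (auto simp: f_cst f_add f_mult)
  moreover have "card (mut S) = card (mut S')"
    using q bij_betw_same_card by blast
  moreover have "bij_betw \<beta> (mut S) (mut S') \<and>
      (\<forall>i\<in>mut S. (\<exists>m\<in>frozen_monomials S'. f (var S i) = m * var S' (\<beta> i)) \<and>
        f (yhat S i) = yhat S' (\<beta> i))"
    using q by simp
  ultimately show ?thesis
    unfolding quasi_cluster_hom_def using seeds.intros(1)[of S] seeds.intros(1)[of S'] by metis
qed

end

section \<open>Positivity and independence of Pluecker coordinates\<close>

definition moment_curve :: "nat \<Rightarrow> ratfun ^ 3" where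
  "moment_curve j = vector [1, cst (of_nat j), cst (of_nat j ^ 2)]"

text \<open>Positivity is tested at a single point, the columns of \<open>moment_curve\<close>.
  Since \<open>subst_to\<close> includes definedness there, the set is closed under subtraction-free
  operations, division included.\<close>

definition pos_set :: "ratfun set" where
  "pos_set = {x. \<exists>r>0. subst_to moment_curve x (cst (complex_of_real r))}"

lemma pos_setI: "subst_to moment_curve x (cst (complex_of_real r)) \<Longrightarrow> r > 0 \<Longrightarrow> x \<in> pos_set"
  unfolding pos_set_def by blast

lemma pos_set_1: "1 \<in> pos_set"
  by (rule pos_setI[of _ 1]) (simp_all add: subst_to_1)

lemma pos_set_add: "x \<in> pos_set \<Longrightarrow> y \<in> pos_set \<Longrightarrow> x + y \<in> pos_set"
  unfolding pos_set_def
  by clarify (metis add_pos_pos cst_add of_real_add subst_to_add)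

lemma pos_set_mult: "x \<in> pos_set \<Longrightarrow> y \<in> pos_set \<Longrightarrow> x * y \<in> pos_set"
  unfolding pos_set_def
  by clarify (metis mult_pos_pos cst_mult of_real_mult subst_to_mult)

lemma pos_set_inverse: "x \<in> pos_set \<Longrightarrow> inverse x \<in> pos_set"
  unfolding pos_set_def
  by clarify (metis cst_eq_0_iff cst_inverse less_numeral_extra(3) of_real_eq_0_iff of_real_inverse
      positive_imp_inverse_positive subst_to_inverse)

lemma pos_set_nonzero: "x \<in> pos_set \<Longrightarrow> x \<noteq> 0"
  unfolding pos_set_def using subst_to_nonzero by fastforce

text \<open>The Vandermonde determinant.\<close>

lemma det3_moment_curve:
  "det3 (moment_curve i) (moment_curve j) (moment_curve k) =
     cst (complex_of_real ((real j - real i) * (real k - real i) * (real k - real j)))"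
  unfolding det3_expand moment_curve_def
  by (simp add: power2_eq_square algebra_simps flip: cst_mult cst_diff cst_add)

lemma pl_pos: "i < j \<Longrightarrow> j < k \<Longrightarrow> pl i j k \<in> pos_set"
  using subst_to_pl[of moment_curve i j k] unfolding det3_moment_curve
  by (rule pos_setI) simp

lemma pl_nonzero: "i < j \<Longrightarrow> j < k \<Longrightarrow> pl i j k \<noteq> 0"
  using pl_pos pos_set_nonzero by blast

text \<open>A test for the columns that occur in an expression: setting column \<open>x\<close> to
  zero kills precisely the coordinates that involve it.\<close>

lemma subst_to_pl_zero:
  "x \<in> {i, j, k} \<Longrightarrow> subst_to (zvec(x := 0)) (pl i j k) 0"
  "x \<notin> {i, j, k} \<Longrightarrow> subst_to (zvec(x := 0)) (pl i j k) (pl i j k)"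
  using subst_to_pl[of "zvec(x := 0)" i j k] by (auto simp: det3_expand pl_def)

text \<open>A column present on one side only could be set to zero, making one side vanish and not
  the other. Distinctness matters because \<open>mutate_at\<close> and \<open>freeze\<close> select
  vertices by their variables.\<close>

lemma pl_eq_iff:
  assumes "i < j" "j < k" "i' < j'" "j' < k'"
  shows "pl i j k = pl i' j' k' \<longleftrightarrow> i = i' \<and> j = j' \<and> k = k'"
proof
  assume eq: "pl i j k = pl i' j' k'"
  have "x \<in> {i', j', k'}" if "x \<in> {i, j, k}" for x
  proof (rule ccontr)
    assume "x \<notin> {i', j', k'}"
    hence "subst_to (zvec(x := 0)) (pl i' j' k') (pl i' j' k')"
      by (rule subst_to_pl_zero)
    moreover have "subst_to (zvec(x := 0)) (pl i' j' k') 0"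
      using subst_to_pl_zero(1)[OF that] eq by simp
    ultimately show False
      using subst_to_unique pl_nonzero[OF assms(3,4)] by blast
  qed
  hence "i \<in> {i', j', k'}" "j \<in> {i', j', k'}" "k \<in> {i', j', k'}"
    by blast+
  thus "i = i' \<and> j = j' \<and> k = k'"
    using assms by auto
qed simp

lemma gr_field_uminus: "x \<in> gr_field N \<Longrightarrow> - x \<in> gr_field N"
  using gr_field.intros(4)[OF gr_field.intros(1)[of "- 1"]] by (fastforce simp: cst_uminus)

lemma gr_field_diff: "x \<in> gr_field N \<Longrightarrow> y \<in> gr_field N \<Longrightarrow> x - y \<in> gr_field N"
  using gr_field.intros(3)[OF _ gr_field_uminus] by fastforce

lemma gr_field_divide: "x \<in> gr_field N \<Longrightarrow> y \<in> gr_field N \<Longrightarrow> x / y \<in> gr_field N"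
  by (simp add: divide_inverse gr_field.intros(4,5))

text \<open>The left inverse \<open>w'\<close> makes the substitution \<open>w\<close> injective, so that denominators do not
  vanish.\<close>

lemma gr_field_subst:
  assumes "\<And>i. i \<in> N \<Longrightarrow> vec_subst_to w' (w i) (zvec i)"
    and "\<And>i j k. i \<in> N \<Longrightarrow> j \<in> N \<Longrightarrow> k \<in> N \<Longrightarrow> det3 (w i) (w j) (w k) \<in> gr_field M"
    and "x \<in> gr_field N"
  shows "\<exists>y\<in>gr_field M. subst_to w x y \<and> subst_to w' y x"
  using assms(3)
proof induction
  case (1 a)
  thus ?case
    using subst_to_cst gr_field.intros(1) by blast
next
  case (2 i j k)
  hence "subst_to w' (det3 (w i) (w j) (w k)) (pl i j k)"
    unfolding pl_def by (intro subst_to_det3 assms(1))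
  thus ?case
    using 2 subst_to_pl assms(2) by blast
next
  case (3 f g)
  thus ?case
    by (meson gr_field.intros(3) subst_to_add)
next
  case (4 f g)
  thus ?case
    by (meson gr_field.intros(4) subst_to_mult)
next
  case (5 f)
  then obtain g where g: "g \<in> gr_field M" "subst_to w f g" "subst_to w' g f"
    by blast
  show ?case
  proof (cases "f = 0")
    case True
    thus ?thesis
      using 5 by auto
  next
    case False
    hence "g \<noteq> 0"
      using g(3) subst_to_nonzero by blast
    thus ?thesis
      using False g by (meson gr_field.intros(5) subst_to_inverse)
  qed
qed

section \<open>The rectangles seed\<close>

lemma rectangles_seed_simps [simp]:
  "verts (rectangles_seed N) = {V0} \<union> {V r c | r c. r \<in> {1..3} \<and> c \<in> {4..card N}}"
  "mut (rectangles_seed N) = {V r c | r c. r \<in> {1..2} \<and> c \<in> {4..card N - 1}}"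
  "var (rectangles_seed N) = rect_var N"
  "arr (rectangles_seed N) u v = of_bool ((u, v) \<in> rect_arrows (card N))"
  by (simp_all add: rectangles_seed_def)

lemma rect_arrows_simps:
  "(u, V0) \<notin> rect_arrows M"
  "(V0, V r c) \<in> rect_arrows M \<longleftrightarrow> r = 1 \<and> c = 4"
  "(V r c, V r' c') \<in> rect_arrows M \<longleftrightarrow>
     (r = 1 \<or> r = 2) \<and> c \<in> {4..M - 1} \<and> (r' = r \<and> c' = c + 1 \<or> r' = r + 1 \<and> c' = c) \<or>
     (r' = 1 \<or> r' = 2) \<and> c' \<in> {4..M - 1} \<and> r = r' + 1 \<and> c = c' + 1"
proof -
  have r: "k = 1 \<or> k = 2 \<longleftrightarrow> k \<in> {1..2}" for k :: nat
    by auto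
  show "(u, V0) \<notin> rect_arrows M" "(V0, V r c) \<in> rect_arrows M \<longleftrightarrow> r = 1 \<and> c = 4"
    "(V r c, V r' c') \<in> rect_arrows M \<longleftrightarrow>
     (r = 1 \<or> r = 2) \<and> c \<in> {4..M - 1} \<and> (r' = r \<and> c' = c + 1 \<or> r' = r + 1 \<and> c' = c) \<or>
     (r' = 1 \<or> r' = 2) \<and> c' \<in> {4..M - 1} \<and> r = r' + 1 \<and> c = c' + 1"
    unfolding rect_arrows_def r by (simp_all del: atLeastAtMost_iff One_nat_def) blast
qed

lemma finite_rectangles_verts: "finite (verts (rectangles_seed N))"
proof -
  have "verts (rectangles_seed N) = insert V0 ((\<lambda>(r, c). V r c) ` ({1..3} \<times> {4..card N}))"
    by (auto simp: image_iff)
  thus ?thesis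
    by simp
qed

lemma two_acyclic_rectangles: "two_acyclic (rectangles_seed N)"
  unfolding two_acyclic_def
proof (intro allI)
  fix u v
  show "arr (rectangles_seed N) u v = 0 \<or> arr (rectangles_seed N) v u = 0"
    by (cases u; cases v) (auto simp: rect_arrows_simps)
qed

lemma prod_power_of_bool:
  assumes "finite A" "B \<subseteq> A" "\<And>i. i \<in> A \<Longrightarrow> g i = of_bool (i \<in> B)"
  shows "(\<Prod>i\<in>A. (x i :: 'a :: comm_semiring_1) ^ g i) = (\<Prod>i\<in>B. x i)"
proof -
  have "(\<Prod>i\<in>A. x i ^ g i) = (\<Prod>i\<in>A. if i \<in> B then x i else 1)"
    using assms(3) by (intro prod.cong) auto
  also have "\<dots> = (\<Prod>i\<in>A \<inter> B. x i)"
    using assms(1) by (simp add: prod.inter_restrict)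
  also have "A \<inter> B = B"
    using assms(2) by blast
  finally show ?thesis .
qed

lemma rect_arrows_row1:
  assumes "j \<in> {4..M - 1}"
  shows "(V 1 j, v) \<in> rect_arrows M \<longleftrightarrow> v \<in> {V 1 (j + 1), V 2 j}"
    and "(v, V 1 j) \<in> rect_arrows M \<longleftrightarrow>
      v \<in> {V 2 (j + 1), if j = 4 then V0 else V 1 (j - 1)}"
proof -
  have j: "4 \<le> j" and J: "j \<in> {4..M - 1}" "j - 1 \<in> {4..M - 1} \<longleftrightarrow> j \<noteq> 4"
    using assms by auto
  show "(V 1 j, v) \<in> rect_arrows M \<longleftrightarrow> v \<in> {V 1 (j + 1), V 2 j}"
    using J j by (cases v) (auto simp: rect_arrows_simps simp del: atLeastAtMost_iff)
  show "(v, V 1 j) \<in> rect_arrows M \<longleftrightarrow>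
      v \<in> {V 2 (j + 1), if j = 4 then V0 else V 1 (j - 1)}"
    using J j by (cases v) (auto simp: rect_arrows_simps simp del: atLeastAtMost_iff)
qed

lemma rect_arrows_row2:
  assumes "j \<in> {4..M - 1}"
  shows "(V 2 j, v) \<in> rect_arrows M \<longleftrightarrow>
      v \<in> {V 2 (j + 1), V 3 j} \<union> (if j = 4 then {} else {V 1 (j - 1)})"
    and "(v, V 2 j) \<in> rect_arrows M \<longleftrightarrow>
      v \<in> {V 1 j, V 3 (j + 1)} \<union> (if j = 4 then {} else {V 2 (j - 1)})"
proof -
  have j: "4 \<le> j" and J: "j \<in> {4..M - 1}" "j - 1 \<in> {4..M - 1} \<longleftrightarrow> j \<noteq> 4"
    using assms by auto
  show "(V 2 j, v) \<in> rect_arrows M \<longleftrightarrow>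
      v \<in> {V 2 (j + 1), V 3 j} \<union> (if j = 4 then {} else {V 1 (j - 1)})"
    using J j by (cases v) (auto simp: rect_arrows_simps simp del: atLeastAtMost_iff)
  show "(v, V 2 j) \<in> rect_arrows M \<longleftrightarrow>
      v \<in> {V 1 j, V 3 (j + 1)} \<union> (if j = 4 then {} else {V 2 (j - 1)})"
    using J j by (cases v) (auto simp: rect_arrows_simps simp del: atLeastAtMost_iff)
qed

lemma arr_rectangles_row1:
  assumes "j \<in> {4..card N - 1}"
  shows "arr (rectangles_seed N) (V 1 j) v = of_bool (v \<in> {V 1 (j + 1), V 2 j})"
    and "arr (rectangles_seed N) v (V 1 j) =
      of_bool (v \<in> {V 2 (j + 1), if j = 4 then V0 else V 1 (j - 1)})"
  unfolding rectangles_seed_simps rect_arrows_row1[OF assms] by (rule refl)+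

lemma arr_rectangles_row2:
  assumes "j \<in> {4..card N - 1}"
  shows "arr (rectangles_seed N) (V 2 j) v =
      of_bool (v \<in> {V 2 (j + 1), V 3 j} \<union> (if j = 4 then {} else {V 1 (j - 1)}))"
    and "arr (rectangles_seed N) v (V 2 j) =
      of_bool (v \<in> {V 1 j, V 3 (j + 1)} \<union> (if j = 4 then {} else {V 2 (j - 1)}))"
  unfolding rectangles_seed_simps rect_arrows_row2[OF assms] by (rule refl)+

lemma arr_prods_rectangles_row1:
  assumes "j \<in> {4..card N - 1}"
  defines "S \<equiv> rectangles_seed N"
  shows "out_prod S (V 1 j) = var S (V 1 (j + 1)) * var S (V 2 j)"
    and "in_prod S (V 1 j) = var S (V 2 (j + 1)) * var S (if j = 4 then V0 else V 1 (j - 1))"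
proof -
  show "out_prod S (V 1 j) = var S (V 1 (j + 1)) * var S (V 2 j)"
    unfolding S_def arr_rectangles_row1[OF assms(1)] using assms(1)
    by (subst prod_power_of_bool[OF finite_rectangles_verts _ refl]) auto
  show "in_prod S (V 1 j) = var S (V 2 (j + 1)) * var S (if j = 4 then V0 else V 1 (j - 1))"
    unfolding S_def arr_rectangles_row1[OF assms(1)] using assms(1)
    by (subst prod_power_of_bool[OF finite_rectangles_verts _ refl]) auto
qed

lemma arr_prods_rectangles_row2:
  assumes "j \<in> {4..card N - 1}"
  defines "S \<equiv> rectangles_seed N"
  shows "out_prod S (V 2 j) = var S (V 2 (j + 1)) * var S (V 3 j) *
      (if j = 4 then 1 else var S (V 1 (j - 1)))"
    and "in_prod S (V 2 j) = var S (V 1 j) * var S (V 3 (j + 1)) *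
      (if j = 4 then 1 else var S (V 2 (j - 1)))"
proof -
  show "out_prod S (V 2 j) = var S (V 2 (j + 1)) * var S (V 3 j) *
      (if j = 4 then 1 else var S (V 1 (j - 1)))"
    unfolding S_def arr_rectangles_row2[OF assms(1)] using assms(1)
    by (subst prod_power_of_bool[OF finite_rectangles_verts _ refl]) (auto simp: mult_ac)
  show "in_prod S (V 2 j) = var S (V 1 j) * var S (V 3 (j + 1)) *
      (if j = 4 then 1 else var S (V 2 (j - 1)))"
    unfolding S_def arr_rectangles_row2[OF assms(1)] using assms(1)
    by (subst prod_power_of_bool[OF finite_rectangles_verts _ refl]) (auto simp: mult_ac)
qed

text \<open>The formulas are uniform in \<open>j\<close>: at \<open>j = 4\<close> the vertices \<open>(1, 3)\<close> and \<open>(2, 3)\<close>, which do not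
  exist, would both carry the variable of \<open>v\<^sub>0\<close>.\<close>

lemma yhat_rectangles:
  assumes "j \<in> {4..card N - 1}" and nz: "pl (nth_elem N 1) (nth_elem N 2) (nth_elem N 3) \<noteq> 0"
  defines "e \<equiv> nth_elem N"
  shows "yhat (rectangles_seed N) (V 1 j) =
      (pl (e 1) (e 2) (e (j + 1)) * pl (e 1) (e (j - 1)) (e j)) /
      (pl (e 1) (e j) (e (j + 1)) * pl (e 1) (e 2) (e (j - 1)))"
    and "yhat (rectangles_seed N) (V 2 j) =
      (pl (e 1) (e j) (e (j + 1)) * pl (e (j - 2)) (e (j - 1)) (e j) * pl (e 1) (e 2) (e (j - 1))) /
      (pl (e 1) (e 2) (e j) * pl (e (j - 1)) (e j) (e (j + 1)) * pl (e 1) (e (j - 2)) (e (j - 1)))"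
  unfolding yhat_def arr_prods_rectangles_row1[OF assms(1)] arr_prods_rectangles_row2[OF assms(1)]
  using nz by (auto simp: e_def numeral_2_eq_2 numeral_3_eq_3)

lemma nth_elem_enum:
  assumes "strict_mono_on {1..m} e" "e ` {1..m} = N"
  shows "card N = m" and "i \<in> {1..m} \<Longrightarrow> nth_elem N i = e i"
proof -
  have inj: "inj_on e {1..m}"
    using assms(1) strict_mono_on_imp_inj_on by blast
  thus "card N = m"
    using assms(2) card_image by fastforce
  have "sorted_wrt (<) (map e [1..<Suc m])"
    unfolding sorted_wrt_map using assms(1)
    by (auto simp: sorted_wrt_iff_nth_less strict_mono_on_def simp del: upt_Suc)
  moreover have "set (map e [1..<Suc m]) = N"
    using assms(2) by (simp only: set_map set_upt atLeastLessThanSuc_atLeastAtMost)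
  moreover have "finite N"
    using assms(2) by blast
  ultimately have "sorted_list_of_set N = map e [1..<Suc m]"
    by (metis set_sorted_list_of_set strict_sorted_equal strict_sorted_list_of_set)
  thus "nth_elem N i = e i" if "i \<in> {1..m}"
    using that by (cases i) (simp_all add: nth_elem_def del: upt_Suc)
qed

lemma mutate_at_eqI:
  assumes "v \<in> mut S" "var S v = x" "\<And>u. u \<in> mut S \<Longrightarrow> var S u = x \<Longrightarrow> u = v"
  shows "mutate_at x S = mutate v S"
proof -
  have "(THE u. u \<in> mut S \<and> var S u = x) = v"
    using assms by (intro the_equality) blast+
  thus ?thesis
    by (simp add: mutate_at_def)
qed

lemma freeze_simps [simp]:
  "verts (freeze X S) = verts S" "mut (freeze X S) = {v \<in> mut S. var S v \<notin> X}"
  "var (freeze X S) = var S" "arr (freeze X S) = arr S"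
  "yhat (freeze X S) = yhat S"
  by (simp_all add: freeze_def yhat_def fun_eq_iff)

declare One_nat_def [simp del]

lemma mut_cases:
  assumes "v \<in> mut (rectangles_seed N)"
  obtains j where "j \<in> {4..card N - 1}" "v = V 1 j" | j where "j \<in> {4..card N - 1}" "v = V 2 j"
proof -
  obtain r j where v: "v = V r j" "r \<in> {1..2}" "j \<in> {4..card N - 1}"
    using assms by auto
  hence "r = 1 \<or> r = 2"
    by auto
  thus ?thesis
    using v that by blast
qed

lemma mem_mut:
  "V 1 j \<in> mut (rectangles_seed N) \<longleftrightarrow> j \<in> {4..card N - 1}"
  "V 2 j \<in> mut (rectangles_seed N) \<longleftrightarrow> j \<in> {4..card N - 1}"
  by auto

lemma rect_var_pos:
  assumes "v \<in> verts (rectangles_seed N)" "card N = m" "4 \<le> m"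
    and "\<And>i. i \<in> {1..m} \<Longrightarrow> nth_elem N i = g i" "\<And>i. i \<in> {1..m} \<Longrightarrow> g i \<in> N"
    and "\<And>i j. i < j \<Longrightarrow> g i < (g j :: nat)"
  shows "rect_var N v \<in> gr_field N \<inter> pos_set"
proof -
  have *: "pl (nth_elem N i) (nth_elem N j) (nth_elem N k) \<in> gr_field N \<inter> pos_set"
    if "i \<in> {1..m}" "j \<in> {1..m}" "k \<in> {1..m}" "i < j" "j < k" for i j k
    using that assms(4-6) pl_pos gr_field.intros(2) by simp
  have m: "1 \<in> {1..m}" "2 \<in> {1..m}" "3 \<in> {1..m}"
    using assms(3) by auto
  consider "v = V0" | r c where "v = V r c" "r \<in> {1..3}" "c \<in> {4..m}"
    using assms(1,2) by auto
  thus ?thesis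
  proof cases
    case 1
    thus ?thesis
      using * m by simp
  next
    case 2
    hence "c \<in> {1..m}" "c - 1 \<in> {1..m}" "c - 2 \<in> {1..m}"
      "1 < c - 1" "c - 1 < c" "2 < c" "c - 2 < c - 1"
      by auto
    thus ?thesis
      using * m 2 by (simp add: rect_var.simps(2) del: atLeastAtMost_iff)
  qed
qed

lemma not_row3_mut: "V 3 j \<notin> mut (rectangles_seed N)"
  by auto

section \<open>The forest promotion\<close>

locale forest =
  fixes n a b c d :: nat
  assumes a5: "5 \<le> a" and b_def: "b = a + 1" and c_def: "c = b + 1" and d_def: "d = c + 1"
    and dn: "d \<le> n"
begin

abbreviation N' :: "nat set" where
  "N' \<equiv> {1..n} - {3, c}"

abbreviation \<Psi> :: "ratfun \<Rightarrow> ratfun" where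
  "\<Psi> \<equiv> forest_promotion a b c d"

definition w :: "nat \<Rightarrow> ratfun ^ 3" where
  "w = zvec(2 := inverse (pl 1 3 4) *s shuffle (zvec 1) (zvec 2) (zvec 3) (zvec 4),
     b := inverse (pl a c d) *s shuffle (zvec a) (zvec b) (zvec c) (zvec d))"

definition Q :: ratfun where
  "Q = pl 1 2 b * pl a c d - pl 1 2 a * pl b c d"

lemma ord: "5 \<le> a" "a < b" "b < c" "c < d" "d \<le> n"
  using a5 b_def c_def d_def dn by simp_all

lemma nz: "pl 1 3 4 \<noteq> 0" "pl a c d \<noteq> 0"
  using ord by (simp_all add: pl_nonzero)

lemma w_shuffle:
  "w 2 = inverse (pl 1 3 4) *s shuffle (zvec 1) (zvec 2) (zvec 3) (zvec 4)"
  "w b = inverse (pl a c d) *s shuffle (zvec a) (zvec b) (zvec c) (zvec d)"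
  using ord by (simp_all add: w_def)

lemma w_2: "w 2 = zvec 2 - (pl 2 3 4 / pl 1 3 4) *s zvec 1"
  unfolding w_shuffle shuffle_def pl_def[symmetric] using nz(1) by (simp add: scale_diff_cancel)

lemma w_b: "w b = zvec b - (pl b c d / pl a c d) *s zvec a"
  unfolding w_shuffle shuffle_def pl_def[symmetric] using nz(2) by (simp add: scale_diff_cancel)

lemma w_other: "i \<noteq> 2 \<Longrightarrow> i \<noteq> b \<Longrightarrow> w i = zvec i"
  by (simp add: w_def)

lemma promotion_pl: "\<Psi> (pl i j k) = det3 (w i) (w j) (w k)"
  unfolding forest_promotion_def w_def by (rule ratfun_subst_eq[OF subst_to_pl])

text \<open>For \<open>z\<^sub>3 = z\<^sub>2\<close> the first shuffle becomes
  \<open>pl 1 2 4 *s zvec 2\<close> and its normalizing factor \<open>pl 1 3 4\<close> becomes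
  \<open>pl 1 2 4\<close>, so that \<open>zvec 2\<close> is left. The same happens at
  \<open>b\<close> when \<open>z\<^sub>c = z\<^sub>b\<close>.\<close>

lemma w_left_inverse:
  assumes "i \<in> N'"
  shows "vec_subst_to (zvec(3 := zvec 2, c := zvec b)) (w i) (zvec i)"
proof -
  let ?v = "zvec(3 := zvec 2, c := zvec b)"
  have v: "vec_subst_to ?v (zvec j) (?v j)" for j
    by (rule vec_subst_to_zvec)
  have "subst_to ?v (pl 1 3 4) (pl 1 2 4)" "subst_to ?v (pl a c d) (pl a b d)"
    using subst_to_pl[of ?v 1 3 4] subst_to_pl[of ?v a c d] ord by (simp_all add: pl_def)
  moreover have "pl 1 2 4 \<noteq> 0" "pl a b d \<noteq> 0"
    using ord by (simp_all add: pl_nonzero)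
  ultimately have inv: "subst_to ?v (inverse (pl 1 3 4)) (inverse (pl 1 2 4))"
    "subst_to ?v (inverse (pl a c d)) (inverse (pl a b d))"
    by (simp_all add: subst_to_inverse)
  consider "i = 2" | "i = b" | "i \<noteq> 2" "i \<noteq> b"
    by blast
  thus ?thesis
  proof cases
    case 1
    have "vec_subst_to ?v (w 2)
        (inverse (pl 1 2 4) *s shuffle (?v 1) (?v 2) (?v 3) (?v 4))"
      unfolding w_shuffle by (intro vec_subst_to_scale inv vec_subst_to_shuffle v)
    moreover have "inverse (pl 1 2 4) *s shuffle (?v 1) (?v 2) (?v 3) (?v 4) = zvec 2"
      using ord \<open>pl 1 2 4 \<noteq> 0\<close> by (simp add: shuffle_def vec_eq_iff flip: pl_def)
    ultimately show ?thesis
      using 1 by simp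
  next
    case 2
    have "vec_subst_to ?v (w b)
        (inverse (pl a b d) *s shuffle (?v a) (?v b) (?v c) (?v d))"
      unfolding w_shuffle by (intro vec_subst_to_scale inv vec_subst_to_shuffle v)
    moreover have "inverse (pl a b d) *s shuffle (?v a) (?v b) (?v c) (?v d) = zvec b"
      using ord \<open>pl a b d \<noteq> 0\<close> by (simp add: shuffle_def vec_eq_iff flip: pl_def)
    ultimately show ?thesis
      using 2 by simp
  next
    case 3
    thus ?thesis
      using v[of i] assms by (simp add: w_other)
  qed
qed

text \<open>Each image column is \<open>zvec i\<close> minus a multiple of another column with
  coefficient in the field, so multilinearity expands the determinant into Pluecker
  coordinates.\<close>

lemma det3_w_in_gr_field:
  assumes "i \<in> N'" "j \<in> N'" "k \<in> N'"
  shows "det3 (w i) (w j) (w k) \<in> gr_field {1..n}"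
proof -
  have pl: "pl i j k \<in> gr_field {1..n}" if "i \<in> {1..n}" "j \<in> {1..n}" "k \<in> {1..n}" for i j k
    using that by (rule gr_field.intros(2))
  have ex: "\<exists>l\<in>gr_field {1..n}. \<exists>m\<in>{1..n}. w i = zvec i - l *s zvec m" if "i \<in> N'" for i
  proof -
    have "pl 2 3 4 / pl 1 3 4 \<in> gr_field {1..n}" "pl b c d / pl a c d \<in> gr_field {1..n}"
      using ord by (auto intro!: gr_field_divide pl)
    moreover have "0 \<in> gr_field {1..n}"
      using gr_field.intros(1)[of 0] by simp
    \<comment> \<open>A dummy correction term gives unchanged columns the same shape as columns 2
      and b.\<close>
    moreover have "w i = zvec i - 0 *s zvec 1" if "i \<noteq> 2" "i \<noteq> b"
      using that by (simp add: w_other vec_eq_iff)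
    moreover have "1 \<in> {1..n}" "a \<in> {1..n}"
      using ord by auto
    ultimately show ?thesis
      using w_2 w_b by (cases "i = 2"; cases "i = b") blast+
  qed
  obtain l m where "l \<in> gr_field {1..n}" "m \<in> {1..n}" "w i = zvec i - l *s zvec m"
    using ex[OF assms(1)] by blast
  moreover obtain l' m' where "l' \<in> gr_field {1..n}" "m' \<in> {1..n}" "w j = zvec j - l' *s zvec m'"
    using ex[OF assms(2)] by blast
  moreover obtain l'' m'' where "l'' \<in> gr_field {1..n}" "m'' \<in> {1..n}" "w k = zvec k - l'' *s zvec m''"
    using ex[OF assms(3)] by blast
  ultimately show ?thesis
    using assms unfolding det3_diff_scale
    by (simp only: det3_diff_scale pl_def[symmetric])
      (intro gr_field_diff gr_field.intros(4) pl; blast)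
qed

lemma promotion_subst:
  assumes "x \<in> gr_field N'"
  shows "\<Psi> x \<in> gr_field {1..n}" "subst_to w x (\<Psi> x)"
proof -
  obtain y where "y \<in> gr_field {1..n}" "subst_to w x y"
    using gr_field_subst[OF w_left_inverse det3_w_in_gr_field assms] by blast
  moreover from this have "\<Psi> x = y"
    unfolding forest_promotion_def w_def by (intro ratfun_subst_eq)
  ultimately show "\<Psi> x \<in> gr_field {1..n}" "subst_to w x (\<Psi> x)"
    by simp_all
qed

lemma promotion_eqI: "subst_to w x y \<Longrightarrow> \<Psi> x = y"
  unfolding forest_promotion_def w_def by (rule ratfun_subst_eq)

sublocale positive_field_hom \<Psi> "gr_field N'" "gr_field N' \<inter> pos_set"
proof
  show "cst x \<in> gr_field N'" for x
    by (rule gr_field.intros(1))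
  show "\<Psi> (cst x) = cst x" for x
    by (intro promotion_eqI subst_to_cst)
  show "\<Psi> (x + y) = \<Psi> x + \<Psi> y" "\<Psi> (x * y) = \<Psi> x * \<Psi> y"
    if "x \<in> gr_field N'" "y \<in> gr_field N'" for x y
    using that by (auto intro!: promotion_eqI subst_to_add subst_to_mult promotion_subst)
  show "1 \<in> gr_field N' \<inter> pos_set"
    using pos_set_1 gr_field.intros(1)[of 1] by simp
qed (auto intro: gr_field.intros pos_set_add pos_set_mult pos_set_inverse dest: pos_set_nonzero)

lemma alg_hom_on_promotion: "alg_hom_on \<Psi> (gr_field N') (gr_field {1..n})"
  unfolding alg_hom_on_def using promotion_subst(1) f_cst f_add f_mult by auto

text \<open>The correction to column 2 is a multiple of \<open>zvec 1\<close>, the one to column b a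
  multiple of \<open>zvec a\<close>. A determinant that already contains this second column does not
  see the correction.\<close>

lemma promotion_pl_fixed:
  "{i, j, k} \<inter> {2, b} = {} \<Longrightarrow> \<Psi> (pl i j k) = pl i j k"
  "i \<noteq> 2 \<Longrightarrow> i \<noteq> b \<Longrightarrow> \<Psi> (pl 1 2 i) = pl 1 2 i"
  "i \<noteq> 2 \<Longrightarrow> i \<noteq> b \<Longrightarrow> \<Psi> (pl i a b) = pl i a b"
  "i \<noteq> 2 \<Longrightarrow> i \<noteq> b \<Longrightarrow> \<Psi> (pl a b i) = pl a b i"
  using ord by (auto simp: promotion_pl w_other w_2 w_b det3_diff_scale simp flip: pl_def)

lemma promotion_pl_12b: "\<Psi> (pl 1 2 b) = Q / pl a c d"
  using ord nz
  by (simp add: promotion_pl w_other w_2 w_b det3_diff_scale Q_def divide_simps flip: pl_def)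

text \<open>The image of \<open>zvec b\<close> lies in the plane of \<open>zvec c\<close> and
  \<open>zvec d\<close>. Next to \<open>zvec d\<close> it acts as a multiple of
  \<open>zvec c\<close>, and the factor \<open>pl a b d / pl a c d\<close> is a frozen monomial of
  the target.\<close>

lemma promotion_pl_1bd: "\<Psi> (pl 1 b d) = pl 1 c d * (pl a b d / pl a c d)"
  using ord nz det3_meet[of "zvec b" "zvec d" "zvec 1" "zvec a" "zvec c"]
  unfolding det3_rotate[of _ _ "zvec 1"]
  unfolding promotion_pl
  by (simp add: w_other w_b det3_diff_scale divide_simps mult_ac flip: pl_def)

lemma promotion_pl_bd:
  assumes "i \<noteq> 2" "i \<noteq> b"
  shows "\<Psi> (pl b d i) = pl c d i * (pl a b d / pl a c d)"
  using assms ord nz det3_meet[of "zvec b" "zvec d" "zvec i" "zvec a" "zvec c"]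
  unfolding promotion_pl
  by (simp add: w_other w_b det3_diff_scale divide_simps mult_ac flip: pl_def)

text \<open>The same mechanism at the other end: the image of \<open>zvec 2\<close> lies in the
  plane of \<open>zvec 3\<close> and \<open>zvec 4\<close>.\<close>

lemma promotion_pl_245: "\<Psi> (pl 2 4 5) = pl 3 4 5 * (pl 1 2 4 / pl 1 3 4)"
  using ord nz det3_meet[of "zvec 2" "zvec 4" "zvec 5" "zvec 1" "zvec 3"]
  unfolding promotion_pl
  by (simp add: w_other w_2 det3_diff_scale divide_simps mult_ac flip: pl_def)

text \<open>The exchange relation of the first mutation, at \<open>V 2 c\<close>. It combines a
  three-term relation among coordinates containing c with one among coordinates containing
  1.\<close>

lemma Q_pl_1bc: "Q * pl 1 b c = pl 1 c d * pl a b c * pl 1 2 b + pl 1 a b * pl 1 2 c * pl b c d"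
proof -
  have "pl a c d * pl 1 b c = pl a b c * pl 1 c d + pl 1 a c * pl b c d"
    using det3_meet[of "zvec b" "zvec c" "zvec 1" "zvec a" "zvec d"]
      det3_rotate[of "zvec b" "zvec c" "zvec 1"] det3_swap(2)[of "zvec a" "zvec c" "zvec d"]
      det3_swap(2)[of "zvec b" "zvec c" "zvec d"] det3_rotate[of "zvec a" "zvec c" "zvec 1"]
      det3_rotate[of "zvec d" "zvec c" "zvec 1"] det3_swap(2)[of "zvec 1" "zvec c" "zvec d"]
    unfolding pl_def by (simp add: algebra_simps)
  moreover have "pl 1 2 b * pl 1 a c - pl 1 2 a * pl 1 b c = pl 1 2 c * pl 1 a b"
    using det3_pluecker[of "zvec 1" "zvec 2" "zvec a" "zvec b" "zvec c"]
    unfolding pl_def by (simp add: algebra_simps)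
  ultimately show ?thesis
    unfolding Q_def by algebra
qed

lemma Q_pl_12a: "pl 1 2 a * pl b c d + Q = pl a c d * pl 1 2 b"
  unfolding Q_def by simp

text \<open>The exchange relation of the third mutation, at \<open>V 1 c\<close>: Cramer's relation
  for columns a, b, c, d. The second one, \<open>Q_pl_12a\<close>, is the definition of
  \<open>Q\<close> itself.\<close>

lemma Q_pl_12d: "Q + pl 1 2 d * pl a b c = pl a b d * pl 1 2 c"
  using det3_cramer[of "zvec 1" "zvec 2" "zvec a" "zvec b" "zvec c" "zvec d"]
  unfolding Q_def pl_def by (simp add: algebra_simps)

text \<open>\<open>Q\<close> is defined by a difference; its exchange relation gives a
  subtraction-free expression after division by \<open>pl 1 b c\<close>.\<close>

lemma Q_pos: "Q \<in> pos_set"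
proof -
  have "pl 1 c d * pl a b c * pl 1 2 b + pl 1 a b * pl 1 2 c * pl b c d \<in> pos_set"
    using ord by (intro pos_set_add pos_set_mult pl_pos) auto
  moreover have "pl 1 b c \<in> pos_set"
    using ord by (intro pl_pos) auto
  moreover have "Q = (Q * pl 1 b c) * inverse (pl 1 b c)"
    using \<open>pl 1 b c \<in> pos_set\<close> pos_set_nonzero by (simp add: mult.assoc)
  ultimately show ?thesis
    unfolding Q_pl_1bc by (metis pos_set_mult pos_set_inverse)
qed

lemma Q_neq_pl:
  assumes "i < j" "j < k"
  shows "Q \<noteq> pl i j k"
proof
  assume eq: "Q = pl i j k"
  \<comment> \<open>Columns 1, 2, a, b occur in both terms of \<open>Q\<close>. A single coordinate
    has three columns and must miss one of these four; setting that one to zero kills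
    \<open>Q\<close> only.\<close>
  have "card {i, j, k} = 3" "card {1, 2, a, b} = 4"
    using assms ord by auto
  hence "\<not> {1, 2, a, b} \<subseteq> {i, j, k}"
    by (metis card_mono finite.emptyI finite_insert numeral_le_iff semiring_norm(69,72))
  then obtain x where x: "x \<in> {1, 2, a, b}" "x \<notin> {i, j, k}"
    by blast
  let ?z = "zvec(x := 0)"
  have zero: "subst_to ?z (pl i j k * pl i' j' k') 0" if "x \<in> {i, j, k} \<union> {i', j', k'}"
    for i j k i' j' k'
  proof (cases "x \<in> {i, j, k}")
    case True
    thus ?thesis
      using subst_to_mult[OF subst_to_pl_zero(1) subst_to_pl] by fastforce
  next
    case False
    hence "x \<in> {i', j', k'}"
      using that by blast
    thus ?thesis
      using subst_to_mult[OF subst_to_pl subst_to_pl_zero(1)] by fastforce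
  qed
  have "subst_to ?z Q (0 - 0)"
    unfolding Q_def using x(1) by (intro subst_to_diff zero) auto
  hence "subst_to ?z Q 0"
    by simp
  moreover have "subst_to ?z Q Q"
    using subst_to_pl_zero(2)[OF x(2)] eq by simp
  ultimately show False
    using subst_to_unique pos_set_nonzero[OF Q_pos] by blast
qed

section \<open>The mutated seed\<close>

text \<open>The increasing enumeration of \<open>N'\<close>. The second jump, over c, comes after
  position a: the element there is b, and position b holds d.\<close>

definition e :: "nat \<Rightarrow> nat" where
  "e j = (if j \<le> 2 then j else if j \<le> a then j + 1 else j + 2)"

lemma e_simps [simp]:
  "e 1 = 1" "e 2 = 2" "3 \<le> j \<Longrightarrow> j \<le> a \<Longrightarrow> e j = j + 1" "b \<le> j \<Longrightarrow> e j = j + 2"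
  using ord by (auto simp: e_def)

lemma e_less: "i < j \<Longrightarrow> e i < e j"
  by (auto simp: e_def)

lemma e_image: "e ` {1..n - 2} = N'"
proof
  show "e ` {1..n - 2} \<subseteq> N'"
    using a5 dn by (auto simp: e_def b_def c_def d_def)
  show "N' \<subseteq> e ` {1..n - 2}"
  proof
    fix i assume i: "i \<in> N'"
    have "i = e (if i \<le> 2 then i else if i < c then i - 1 else i - 2)"
      using i a5 dn by (auto simp: e_def b_def c_def d_def)
    moreover have "(if i \<le> 2 then i else if i < c then i - 1 else i - 2) \<in> {1..n - 2}"
      using i a5 dn by (auto simp: b_def c_def d_def)
    ultimately show "i \<in> e ` {1..n - 2}"
      by blast
  qed
qed

lemma strict_mono_on_e: "strict_mono_on {1..n - 2} e"
  by (simp add: strict_mono_on_def e_less)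

lemmas card_N' [simp] = nth_elem_enum(1)[OF strict_mono_on_e e_image]
  and nth_elem_N' = nth_elem_enum(2)[OF strict_mono_on_e e_image]

lemma e_in_N': "j \<in> {1..n - 2} \<Longrightarrow> e j \<in> N'"
  using e_image by blast

lemma nth_elem_full: "j \<in> {1..n} \<Longrightarrow> nth_elem {1..n} j = j"
  by (rule nth_elem_enum(2)[of n "\<lambda>j. j"]) (auto simp: strict_mono_on_def)

section \<open>The three mutations of the large rectangles seed\<close>

abbreviation R0 :: "vertex seed" where
  "R0 \<equiv> rectangles_seed {1..n}"

definition R1 :: "vertex seed" where
  "R1 = mutate (V 2 c) R0"

definition R2 :: "vertex seed" where
  "R2 = mutate (V 1 b) R1"

definition R3 :: "vertex seed" where
  "R3 = mutate (V 1 c) R2"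

lemma R_simps [simp]:
  "verts R1 = verts R0" "verts R2 = verts R0" "verts R3 = verts R0"
  "mut R1 = mut R0" "mut R2 = mut R0" "mut R3 = mut R0"
  by (simp_all add: R1_def R2_def R3_def)

lemma two_acyclic_R [simp]: "two_acyclic R0" "two_acyclic R1" "two_acyclic R2" "two_acyclic R3"
  by (simp_all add: two_acyclic_rectangles two_acyclic_mutate R1_def R2_def R3_def)

lemma var_R0 [simp]:
  "rect_var {1..n} V0 = pl 1 2 3"
  "j \<in> {4..n} \<Longrightarrow> rect_var {1..n} (V 1 j) = pl 1 2 j"
  "j \<in> {4..n} \<Longrightarrow> rect_var {1..n} (V 2 j) = pl 1 (j - 1) j"
  "j \<in> {4..n} \<Longrightarrow> rect_var {1..n} (V 3 j) = pl (j - 2) (j - 1) j"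
proof -
  show "rect_var {1..n} V0 = pl 1 2 3"
    using ord by (simp add: nth_elem_full)
  assume j: "j \<in> {4..n}"
  hence "j - 1 \<in> {1..n}" "j - 2 \<in> {1..n}" "j \<in> {1..n}"
    by auto
  thus "rect_var {1..n} (V 1 j) = pl 1 2 j" "rect_var {1..n} (V 2 j) = pl 1 (j - 1) j"
    "rect_var {1..n} (V 3 j) = pl (j - 2) (j - 1) j"
    using j ord by (simp_all add: nth_elem_full del: atLeastAtMost_iff)
      (simp_all add: nth_elem_full)
qed

declare rect_var.simps(2) [simp del] rectangles_seed_simps(4) [simp del]

lemma pred: "b - 1 = a" "c - 1 = b" "d - 1 = c" "c - 2 = a" "d - 2 = b" "c + 1 = d" "b + 1 = c"
    "a + 1 = b"
  by (simp_all add: b_def c_def d_def)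

lemma R0_prods:
  "out_prod R0 (V 2 c) = pl 1 c d * pl a b c * pl 1 2 b"
  "in_prod R0 (V 2 c) = pl 1 a b * pl 1 2 c * pl b c d"
proof -
  have "c \<in> {4..card {1..n} - 1}" "c \<noteq> 4"
    using ord by auto
  note p = arr_prods_rectangles_row2[OF this(1)]
  show "out_prod R0 (V 2 c) = pl 1 c d * pl a b c * pl 1 2 b"
    "in_prod R0 (V 2 c) = pl 1 a b * pl 1 2 c * pl b c d"
    unfolding p using ord \<open>c \<noteq> 4\<close> by (simp_all add: pred)
qed

lemma var_R1: "var R1 = (rect_var {1..n})(V 2 c := Q)"
proof -
  have "(in_prod R0 (V 2 c) + out_prod R0 (V 2 c)) / var R0 (V 2 c) = Q"
    unfolding R0_prods using Q_pl_1bc ord pl_nonzero[of 1 b c] by (simp add: divide_simps pred)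
  thus ?thesis
    unfolding R1_def mutate_simps by simp
qed

lemma distinct_abcd [simp]:
  "a \<noteq> b" "b \<noteq> a" "a \<noteq> c" "c \<noteq> a" "a \<noteq> d" "d \<noteq> a"
  "b \<noteq> c" "c \<noteq> b" "b \<noteq> d" "d \<noteq> b" "c \<noteq> d" "d \<noteq> c"
  using ord by auto

lemma arr_R0:
  "arr R0 (V 2 c) v = of_bool (v \<in> {V 2 d, V 3 c, V 1 b})"
  "arr R0 v (V 2 c) = of_bool (v \<in> {V 2 b, V 1 c, V 3 d})"
  "arr R0 (V 1 b) v = of_bool (v \<in> {V 1 c, V 2 b})"
  "arr R0 v (V 1 b) = of_bool (v \<in> {V 2 c, V 1 a})"
  "arr R0 (V 1 c) v = of_bool (v \<in> {V 1 d, V 2 c})"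
  "arr R0 v (V 1 c) = of_bool (v \<in> {V 2 d, V 1 b})"
proof -
  have bc: "b \<in> {4..card {1..n} - 1}" "c \<in> {4..card {1..n} - 1}" "b \<noteq> 4" "c \<noteq> 4"
    using ord by auto
  note p = arr_rectangles_row1[OF bc(1)] arr_rectangles_row1[OF bc(2)] arr_rectangles_row2[OF bc(2)]
  show "arr R0 (V 2 c) v = of_bool (v \<in> {V 2 d, V 3 c, V 1 b})"
    "arr R0 v (V 2 c) = of_bool (v \<in> {V 2 b, V 1 c, V 3 d})"
    "arr R0 (V 1 b) v = of_bool (v \<in> {V 1 c, V 2 b})"
    "arr R0 v (V 1 b) = of_bool (v \<in> {V 2 c, V 1 a})"
    "arr R0 (V 1 c) v = of_bool (v \<in> {V 1 d, V 2 c})"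
    "arr R0 v (V 1 c) = of_bool (v \<in> {V 2 d, V 1 b})"
    unfolding p using bc(3,4) by (auto simp: pred)
qed

text \<open>Only the neighbourhood of the next vertex to be mutated is followed. Paths through
  \<open>V 2 c\<close> cancel the arrows from \<open>V 1 b\<close> to \<open>V 1 c\<close> and
  \<open>V 2 b\<close>, and add one from \<open>V 3 d\<close>.\<close>

lemma arr_R1_b:
  "arr R1 v (V 1 b) = of_bool (v \<in> {V 1 a, V 3 d})"
  "arr R1 (V 1 b) v = of_bool (v \<in> {V 2 c})"
  by (auto simp: R1_def arr_mutate arr_R0)

lemma R1_prods:
  "in_prod R1 (V 1 b) = pl 1 2 a * pl b c d" "out_prod R1 (V 1 b) = Q"
proof -
  have "in_prod R1 (V 1 b) = (\<Prod>v\<in>{V 1 a, V 3 d}. var R1 v)"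
    unfolding arr_R1_b R_simps using ord
    by (intro prod_power_of_bool[OF finite_rectangles_verts _ refl]) auto
  thus "in_prod R1 (V 1 b) = pl 1 2 a * pl b c d"
    using ord by (simp add: var_R1 pred)
  have "out_prod R1 (V 1 b) = (\<Prod>v\<in>{V 2 c}. var R1 v)"
    unfolding arr_R1_b R_simps using ord
    by (intro prod_power_of_bool[OF finite_rectangles_verts _ refl]) auto
  thus "out_prod R1 (V 1 b) = Q"
    by (simp add: var_R1)
qed

lemma var_R2: "var R2 = (rect_var {1..n})(V 2 c := Q, V 1 b := pl a c d)"
proof -
  have "(in_prod R1 (V 1 b) + out_prod R1 (V 1 b)) / var R1 (V 1 b) = pl a c d"
    unfolding R1_prods Q_pl_12a using ord pl_nonzero[of 1 2 b] by (simp add: var_R1)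
  thus ?thesis
    unfolding R2_def mutate_simps by (simp add: var_R1)
qed

lemma arr_R1_c:
  "arr R1 v (V 1 c) = of_bool (v \<in> {V 2 c})"
  "arr R1 (V 1 c) v = of_bool (v \<in> {V 1 d, V 3 c})"
  by (auto simp: R1_def arr_mutate arr_R0)

text \<open>After the first mutation \<open>V 1 b\<close> and \<open>V 1 c\<close> are not adjacent,
  so the second one leaves the neighbourhood of \<open>V 1 c\<close> alone.\<close>

lemma arr_R2_c:
  "arr R2 v (V 1 c) = of_bool (v \<in> {V 2 c})"
  "arr R2 (V 1 c) v = of_bool (v \<in> {V 1 d, V 3 c})"
  by (auto simp: R2_def arr_mutate arr_R1_b arr_R1_c)

lemma R2_prods:
  "in_prod R2 (V 1 c) = Q" "out_prod R2 (V 1 c) = pl 1 2 d * pl a b c"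
proof -
  have "in_prod R2 (V 1 c) = (\<Prod>v\<in>{V 2 c}. var R2 v)"
    unfolding arr_R2_c R_simps using ord
    by (intro prod_power_of_bool[OF finite_rectangles_verts _ refl]) auto
  thus "in_prod R2 (V 1 c) = Q"
    by (simp add: var_R2)
  have "out_prod R2 (V 1 c) = (\<Prod>v\<in>{V 1 d, V 3 c}. var R2 v)"
    unfolding arr_R2_c R_simps using ord
    by (intro prod_power_of_bool[OF finite_rectangles_verts _ refl]) auto
  thus "out_prod R2 (V 1 c) = pl 1 2 d * pl a b c"
    using ord by (simp add: var_R2 pred)
qed

lemma var_R3: "var R3 = (rect_var {1..n})(V 2 c := Q, V 1 b := pl a c d, V 1 c := pl a b d)"
proof -
  have "(in_prod R2 (V 1 c) + out_prod R2 (V 1 c)) / var R2 (V 1 c) = pl a b d"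
    unfolding R2_prods Q_pl_12d using ord pl_nonzero[of 1 2 c] by (simp add: var_R2)
  thus ?thesis
    unfolding R3_def mutate_simps by (simp add: var_R2)
qed

text \<open>All mutable variables of \<open>R0\<close> contain column 1. The third part therefore
  excludes \<open>pl a c d\<close> and \<open>pl a b d\<close> as variables of further mutable
  vertices, as needed for freezing.\<close>

lemma rect_var_mut_eq_iff:
  assumes "v \<in> mut R0" "4 \<le> i" "i \<le> n"
  shows "rect_var {1..n} v = pl 1 2 i \<longleftrightarrow> v = V 1 i"
    and "rect_var {1..n} v = pl 1 (i - 1) i \<longleftrightarrow> v = V 2 i"
    and "5 \<le> h \<Longrightarrow> h < i \<Longrightarrow> i < k \<Longrightarrow> rect_var {1..n} v \<noteq> pl h i k"
  using assms(1)
  by (cases rule: mut_cases; use assms(2,3) in \<open>force simp: pl_eq_iff\<close>)+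

lemma R1_eq: "mutate_at (pl 1 b c) R0 = R1"
  unfolding R1_def
proof (rule mutate_at_eqI)
  show "V 2 c \<in> mut R0"
    using ord by (simp only: mem_mut) simp
  show "var R0 (V 2 c) = pl 1 b c"
    using ord by (simp add: pred)
  show "u = V 2 c" if "u \<in> mut R0" "var R0 u = pl 1 b c" for u
    using rect_var_mut_eq_iff(2)[OF that(1), of c] that(2) ord by (simp add: pred)
qed

lemma R2_eq: "mutate_at (pl 1 2 b) R1 = R2"
  unfolding R2_def
proof (rule mutate_at_eqI)
  show "V 1 b \<in> mut R1"
    using ord by (simp only: mem_mut R_simps) simp
  show "var R1 (V 1 b) = pl 1 2 b"
    using ord by (simp add: var_R1)
  show "u = V 1 b" if "u \<in> mut R1" "var R1 u = pl 1 2 b" for u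
    using rect_var_mut_eq_iff(1)[of u b] that ord Q_neq_pl[of 1 2 b]
    unfolding R_simps by (simp add: var_R1 split: if_splits)
qed

lemma R3_eq: "mutate_at (pl 1 2 c) R2 = R3"
  unfolding R3_def
proof (rule mutate_at_eqI)
  show "V 1 c \<in> mut R2"
    using ord by (simp only: mem_mut R_simps) simp
  show "var R2 (V 1 c) = pl 1 2 c"
    using ord by (simp add: var_R2)
  show "u = V 1 c" if "u \<in> mut R2" "var R2 u = pl 1 2 c" for u
    using rect_var_mut_eq_iff(1)[of u c] that ord Q_neq_pl[of 1 2 c] pl_eq_iff[of a c d 1 2 c]
    unfolding R_simps by (simp add: var_R2 split: if_splits)
qed

definition \<Sigma>' :: "vertex seed" where
  "\<Sigma>' = freeze {pl 1 3 4, pl 1 2 4, pl a c d, pl a b d} R3"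

text \<open>Column 4 carries \<open>pl 1 2 4\<close> and \<open>pl 1 3 4\<close>, while
  \<open>V 1 b\<close> and \<open>V 1 c\<close> carry the mutated variables \<open>pl a c d\<close>
  and \<open>pl a b d\<close>. By \<open>Q_neq_pl\<close> the vertex \<open>V 2 c\<close> stays
  mutable.\<close>

lemma mut_\<Sigma>': "mut \<Sigma>' = mut R0 - {V 1 4, V 2 4, V 1 b, V 1 c}"
proof -
  have "var R3 v \<in> {pl 1 3 4, pl 1 2 4, pl a c d, pl a b d} \<longleftrightarrow> v \<in> {V 1 4, V 2 4, V 1 b, V 1 c}"
    if v: "v \<in> mut R0" for v
  proof (cases "v \<in> {V 2 c, V 1 b, V 1 c}")
    case True
    thus ?thesis
      using Q_neq_pl[of 1 3 4] Q_neq_pl[of 1 2 4] Q_neq_pl[of a c d] Q_neq_pl[of a b d] ord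
      by (auto simp: var_R3)
  next
    case False
    thus ?thesis
      using rect_var_mut_eq_iff[OF v] ord
        rect_var_mut_eq_iff(2)[OF v, of 4]
      by (simp add: var_R3) blast
  qed
  thus ?thesis
    unfolding \<Sigma>'_def freeze_simps R_simps by blast
qed

lemma \<Sigma>'_simps [simp]:
  "verts \<Sigma>' = verts R0" "var \<Sigma>' = var R3" "arr \<Sigma>' = arr R3" "yhat \<Sigma>' = yhat R3"
  by (simp_all add: \<Sigma>'_def)

section \<open>Positivity and exchange ratios along the mutations\<close>

lemma R0_pos: "v \<in> verts R0 \<Longrightarrow> rect_var {1..n} v \<in> pos_set"
  using rect_var_pos[of v "{1..n}" n "\<lambda>i. i"] ord nth_elem_full by auto

lemma S_pos: "v \<in> verts (rectangles_seed N') \<Longrightarrow> rect_var N' v \<in> gr_field N' \<inter> pos_set"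
  using rect_var_pos[of v "N'" "n - 2" e] ord nth_elem_N' e_in_N' e_less by auto

lemma R_pos:
  assumes "v \<in> verts R0"
  shows "var R1 v \<in> pos_set" "var R2 v \<in> pos_set" "var R3 v \<in> pos_set"
  using R0_pos[OF assms] Q_pos pl_pos[of a c d] pl_pos[of a b d] ord
  by (auto simp: var_R1 var_R2 var_R3)

lemma verts_special: "V 2 c \<in> verts R0" "V 1 b \<in> verts R0" "V 1 c \<in> verts R0"
  using ord by auto

lemma R_nonzero:
  "\<forall>v\<in>verts R0. var R0 v \<noteq> 0" "\<forall>v\<in>verts R1. var R1 v \<noteq> 0" "\<forall>v\<in>verts R2. var R2 v \<noteq> 0"
  unfolding R_simps rectangles_seed_simps(3) using R0_pos R_pos pos_set_nonzero by blast+

lemma finite_R: "finite (verts R0)" "finite (verts R1)" "finite (verts R2)"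
  unfolding R_simps by (rule finite_rectangles_verts)+

text \<open>The relations for \<open>Q\<close> turn each of the three exchange binomials into a
  product, so every exchange ratio remains a monomial in Pluecker coordinates and
  \<open>Q\<close>.\<close>

lemma yhat_R1:
  assumes "i \<noteq> V 2 c"
  shows "yhat R1 i = yhat R0 i * (pl 1 c d * pl a b c * pl 1 2 b / (Q * pl 1 b c)) ^ arr R0 i (V 2 c)
    * (Q * pl 1 b c / (pl 1 a b * pl 1 2 c * pl b c d)) ^ arr R0 (V 2 c) i"
proof -
  have s: "pl 1 a b * pl 1 2 c * pl b c d + pl 1 c d * pl a b c * pl 1 2 b = Q * pl 1 b c"
    unfolding Q_pl_1bc by (rule add.commute)
  have "Q * pl 1 b c \<noteq> 0"
    using pos_set_nonzero[OF Q_pos] pl_nonzero[of 1 b c] ord by simp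
  thus ?thesis
    unfolding R1_def
    using yhat_mutate_prods[OF finite_R(1) R_nonzero(1) verts_special(1)
        two_acyclic_loop[OF two_acyclic_R(1)] _ assms]
    unfolding R0_prods s by blast
qed

lemma yhat_R2:
  assumes "i \<noteq> V 1 b"
  shows "yhat R2 i = yhat R1 i * (Q / (pl a c d * pl 1 2 b)) ^ arr R1 i (V 1 b)
    * (pl a c d * pl 1 2 b / (pl 1 2 a * pl b c d)) ^ arr R1 (V 1 b) i"
proof -
  have v: "V 1 b \<in> verts R1"
    using verts_special by (simp only: R_simps)
  have "pl a c d * pl 1 2 b \<noteq> 0"
    using pl_nonzero[of a c d] pl_nonzero[of 1 2 b] ord by simp
  thus ?thesis
    unfolding R2_def
    using yhat_mutate_prods[OF finite_R(2) R_nonzero(2) v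
        two_acyclic_loop[OF two_acyclic_R(2)] _ assms]
    unfolding R1_prods Q_pl_12a by blast
qed

lemma yhat_R3:
  assumes "i \<noteq> V 1 c"
  shows "yhat R3 i = yhat R2 i * (pl 1 2 d * pl a b c / (pl a b d * pl 1 2 c)) ^ arr R2 i (V 1 c)
    * (pl a b d * pl 1 2 c / Q) ^ arr R2 (V 1 c) i"
proof -
  have v: "V 1 c \<in> verts R2"
    using verts_special by (simp only: R_simps)
  have "pl a b d * pl 1 2 c \<noteq> 0"
    using pl_nonzero[of a b d] pl_nonzero[of 1 2 c] ord by simp
  thus ?thesis
    unfolding R3_def
    using yhat_mutate_prods[OF finite_R(3) R_nonzero(3) v
        two_acyclic_loop[OF two_acyclic_R(3)] _ assms]
    unfolding R2_prods Q_pl_12d by blast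
qed

lemma yhat_R0:
  assumes "j \<in> {4..n - 1}"
  shows "yhat R0 (V 1 j) = (pl 1 2 (j + 1) * pl 1 (j - 1) j) / (pl 1 j (j + 1) * pl 1 2 (j - 1))"
    and "yhat R0 (V 2 j) = (pl 1 j (j + 1) * pl (j - 2) (j - 1) j * pl 1 2 (j - 1)) /
      (pl 1 2 j * pl (j - 1) j (j + 1) * pl 1 (j - 2) (j - 1))"
proof -
  have j: "j \<in> {4..card {1..n} - 1}"
    using assms by simp
  have "1 \<in> {1..n}" "2 \<in> {1..n}" "3 \<in> {1..n}" "j \<in> {1..n}" "j + 1 \<in> {1..n}"
    "j - 1 \<in> {1..n}" "j - 2 \<in> {1..n}"
    using assms by auto
  note e = this[THEN nth_elem_full]
  have nz: "pl (nth_elem {1..n} 1) (nth_elem {1..n} 2) (nth_elem {1..n} 3) \<noteq> 0"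
    unfolding e by (simp add: pl_nonzero)
  show "yhat R0 (V 1 j) = (pl 1 2 (j + 1) * pl 1 (j - 1) j) / (pl 1 j (j + 1) * pl 1 2 (j - 1))"
    "yhat R0 (V 2 j) = (pl 1 j (j + 1) * pl (j - 2) (j - 1) j * pl 1 2 (j - 1)) /
      (pl 1 2 j * pl (j - 1) j (j + 1) * pl 1 (j - 2) (j - 1))"
    using yhat_rectangles[OF j nz] unfolding e by blast+
qed

section \<open>The smaller seed and the vertex correspondence\<close>

abbreviation \<Sigma> :: "vertex seed" where
  "\<Sigma> \<equiv> rectangles_seed N'"

lemma promotion_yhat_S:
  assumes "j \<in> {4..n - 3}"
  shows "\<Psi> (yhat \<Sigma> (V 1 j)) =
      (\<Psi> (pl 1 2 (e (j + 1))) * \<Psi> (pl 1 (e (j - 1)) (e j))) /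
      (\<Psi> (pl 1 (e j) (e (j + 1))) * \<Psi> (pl 1 2 (e (j - 1))))"
    and "\<Psi> (yhat \<Sigma> (V 2 j)) =
      (\<Psi> (pl 1 (e j) (e (j + 1))) * \<Psi> (pl (e (j - 2)) (e (j - 1)) (e j)) *
        \<Psi> (pl 1 2 (e (j - 1)))) /
      (\<Psi> (pl 1 2 (e j)) * \<Psi> (pl (e (j - 1)) (e j) (e (j + 1))) *
        \<Psi> (pl 1 (e (j - 2)) (e (j - 1))))"
proof -
  have j: "j \<in> {4..card N' - 1}"
    using assms by simp
  have mem: "1 \<in> {1..n - 2}" "2 \<in> {1..n - 2}" "3 \<in> {1..n - 2}" "j \<in> {1..n - 2}"
    "j + 1 \<in> {1..n - 2}" "j - 1 \<in> {1..n - 2}" "j - 2 \<in> {1..n - 2}"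
    using assms by auto
  have e12: "nth_elem N' 1 = 1" "nth_elem N' 2 = 2"
    using mem[THEN nth_elem_N'] by simp_all
  note e = mem(3-)[THEN nth_elem_N'] e12
  note K = mem[THEN e_in_N', unfolded e_simps(1,2)]
  have pl_K: "pl x y z \<in> gr_field N'" if "x \<in> N'" "y \<in> N'" "z \<in> N'" for x y z
    using that by (rule gr_field.intros(2))
  have nz: "pl (nth_elem N' 1) (nth_elem N' 2) (nth_elem N' 3) \<noteq> 0"
    unfolding e using ord by (simp add: pl_nonzero)
  show "\<Psi> (yhat \<Sigma> (V 1 j)) =
      (\<Psi> (pl 1 2 (e (j + 1))) * \<Psi> (pl 1 (e (j - 1)) (e j))) /
      (\<Psi> (pl 1 (e j) (e (j + 1))) * \<Psi> (pl 1 2 (e (j - 1))))"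
    unfolding yhat_rectangles(1)[OF j nz] e
    by (simp only: f_divide f_mult pl_K K K_mult)
  show "\<Psi> (yhat \<Sigma> (V 2 j)) =
      (\<Psi> (pl 1 (e j) (e (j + 1))) * \<Psi> (pl (e (j - 2)) (e (j - 1)) (e j)) *
        \<Psi> (pl 1 2 (e (j - 1)))) /
      (\<Psi> (pl 1 2 (e j)) * \<Psi> (pl (e (j - 1)) (e j) (e (j + 1))) *
        \<Psi> (pl 1 (e (j - 2)) (e (j - 1))))"
    unfolding yhat_rectangles(2)[OF j nz] e
    by (simp only: f_divide f_mult pl_K K K_mult)
qed

text \<open>Columns are transported by \<open>e\<close>, with one exception. Since
  \<open>e a = b\<close> and \<open>V 1 b\<close> is frozen, \<open>V 1 a\<close> is sent to
  \<open>V 2 c\<close>, which \<open>e\<close> skips and which carries \<open>Q\<close>, the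
  numerator of the image of \<open>pl 1 2 b\<close>.\<close>

definition \<beta> :: "vertex \<Rightarrow> vertex" where
  "\<beta> v = (case v of V0 \<Rightarrow> V0 | V r j \<Rightarrow> if r = 1 \<and> j = a then V 2 c else V r (e j))"

lemma \<beta>_V:
  "j \<noteq> a \<Longrightarrow> \<beta> (V 1 j) = V 1 (e j)" "\<beta> (V 1 a) = V 2 c" "\<beta> (V 2 j) = V 2 (e j)"
  by (simp_all add: \<beta>_def)

lemma \<beta>_simps:
  "j < a \<Longrightarrow> 4 \<le> j \<Longrightarrow> \<beta> (V 1 j) = V 1 (j + 1)" "\<beta> (V 1 a) = V 2 c"
  "b \<le> j \<Longrightarrow> 4 \<le> j \<Longrightarrow> \<beta> (V 1 j) = V 1 (j + 2)"
  "j \<le> a \<Longrightarrow> 4 \<le> j \<Longrightarrow> \<beta> (V 2 j) = V 2 (j + 1)"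
  "b \<le> j \<Longrightarrow> 4 \<le> j \<Longrightarrow> \<beta> (V 2 j) = V 2 (j + 2)"
  using ord by (auto simp: \<beta>_V)

lemma e_inj: "e i = e j \<longleftrightarrow> i = j"
  by (metis e_less linorder_neqE_nat less_irrefl)

lemma e_image_mut: "e ` {4..n - 3} = {5..n - 1} - {c}"
proof
  show "e ` {4..n - 3} \<subseteq> {5..n - 1} - {c}"
    using a5 dn by (auto simp: e_def b_def c_def d_def)
  show "{5..n - 1} - {c} \<subseteq> e ` {4..n - 3}"
  proof
    fix i assume i: "i \<in> {5..n - 1} - {c}"
    have "i = e (if i < c then i - 1 else i - 2)"
      using i a5 dn by (auto simp: e_def b_def c_def d_def)
    moreover have "(if i < c then i - 1 else i - 2) \<in> {4..n - 3}"
      using i a5 dn by (auto simp: b_def c_def d_def)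
    ultimately show "i \<in> e ` {4..n - 3}"
      by blast
  qed
qed

lemma e_eq: "e a = b" "e j \<noteq> c"
  using a5 by (auto simp: e_def b_def c_def)

lemma \<beta>_bij: "bij_betw \<beta> (mut \<Sigma>) (mut \<Sigma>')"
proof -
  have card: "card N' - 1 = n - 3"
    by simp
  have mem: "V 1 j \<in> mut \<Sigma>' \<longleftrightarrow> j \<in> {5..n - 1} - {b, c}" "V 2 j \<in> mut \<Sigma>' \<longleftrightarrow> j \<in> {5..n - 1}" for j
    unfolding mut_\<Sigma>' by auto
  have "inj_on \<beta> (mut \<Sigma>)"
  proof (rule inj_onI)
    fix u v assume "u \<in> mut \<Sigma>" "v \<in> mut \<Sigma>" "\<beta> u = \<beta> v"
    have \<beta>: "\<beta> (V 1 j) = (if j = a then V 2 c else V 1 (e j))" "\<beta> (V 2 j) = V 2 (e j)" for j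
      by (simp_all add: \<beta>_V)
    show "u = v"
    proof (cases rule: mut_cases[OF \<open>u \<in> mut \<Sigma>\<close>]; cases rule: mut_cases[OF \<open>v \<in> mut \<Sigma>\<close>])
    qed (use \<open>\<beta> u = \<beta> v\<close> e_eq(2) in \<open>simp_all add: \<beta> e_inj split: if_splits\<close>, metis+)
  qed
  moreover have "\<beta> v \<in> mut \<Sigma>'" if "v \<in> mut \<Sigma>" for v
    using that
  proof (cases rule: mut_cases)
    case (1 j)
    hence "e j \<in> {5..n - 1} - {c}"
      using e_image_mut unfolding card by blast
    moreover have "e j = b \<longleftrightarrow> j = a"
      using e_eq(1) e_inj by metis
    moreover have "c \<in> {5..n - 1}"
      using ord by auto
    ultimately show ?thesis
      unfolding 1(2) by (cases "j = a") (simp_all only: \<beta>_V mem simp_thms Diff_iff insert_iff empty_iff)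
  next
    case (2 j)
    hence "e j \<in> {5..n - 1} - {c}"
      using e_image_mut unfolding card by blast
    thus ?thesis
      unfolding 2(2) \<beta>_V mem by blast
  qed
  moreover have "v \<in> \<beta> ` mut \<Sigma>" if v: "v \<in> mut \<Sigma>'" for v
  proof -
    have "v \<in> mut R0"
      using v unfolding mut_\<Sigma>' by blast
    thus ?thesis
    proof (cases rule: mut_cases)
      case (1 k)
      hence "k \<in> {5..n - 1} - {c}" "k \<noteq> b"
        using v mem by auto
      then obtain j where "j \<in> {4..n - 3}" "k = e j"
        using e_image_mut by blast
      moreover from this have "j \<noteq> a"
        using e_eq \<open>k \<noteq> b\<close> by blast
      ultimately show ?thesis
        unfolding 1(2) by (intro image_eqI[of _ _ "V 1 j"]) (simp_all only: \<beta>_V mem_mut card simp_thms)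
    next
      case (2 k)
      show ?thesis
      proof (cases "k = c")
        case True
        have "V 1 a \<in> mut \<Sigma>"
          using ord by (simp only: mem_mut card) simp
        thus ?thesis
          unfolding 2(2) True by (intro image_eqI[of _ _ "V 1 a"]) (simp_all only: \<beta>_V)
      next
        case False
        hence "k \<in> {5..n - 1} - {c}"
          using v mem 2 by auto
        then obtain j where "j \<in> {4..n - 3}" "k = e j"
          using e_image_mut by blast
        thus ?thesis
          unfolding 2(2) by (intro image_eqI[of _ _ "V 2 j"]) (simp_all only: \<beta>_V mem_mut card)
      qed
    qed
  qed
  ultimately show ?thesis
    unfolding bij_betw_def by blast
qed

text \<open>Excluded are the three mutated vertices and their neighbours at the moment of mutation;
  an exchange ratio changes nowhere else.\<close>

lemma yhat_R3_generic:
  assumes "v \<notin> {V 2 c, V 1 b, V 1 c, V 2 b, V 2 d, V 1 a, V 1 d, V 3 c, V 3 d}"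
  shows "yhat R3 v = yhat R0 v"
proof -
  have v: "v \<noteq> V 2 c" "v \<noteq> V 1 b" "v \<noteq> V 1 c"
    using assms by auto
  show ?thesis
    unfolding yhat_R3[OF v(3)] yhat_R2[OF v(2)] yhat_R1[OF v(1)] arr_R2_c arr_R1_b arr_R0
    using assms by simp
qed

text \<open>Each factor comes from one mutation. The ratio at \<open>V 2 c\<close> sees all three:
  it is inverted by the first and then corrected as a neighbour of \<open>V 1 b\<close> and of
  \<open>V 1 c\<close>.\<close>

lemma yhat_R3_special:
  "yhat R3 (V 1 a) = yhat R0 (V 1 a) * (Q / (pl a c d * pl 1 2 b))"
  "yhat R3 (V 2 b) = yhat R0 (V 2 b) * (pl 1 c d * pl a b c * pl 1 2 b / (Q * pl 1 b c))"
  "yhat R3 (V 2 d) = yhat R0 (V 2 d) * (Q * pl 1 b c / (pl 1 a b * pl 1 2 c * pl b c d))"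
  "yhat R3 (V 1 d) = yhat R0 (V 1 d) * (pl a b d * pl 1 2 c / Q)"
  "yhat R3 (V 2 c) = (pl 1 a b * pl 1 2 c * pl b c d) / (pl 1 c d * pl a b c * pl 1 2 b) *
     (pl a c d * pl 1 2 b / (pl 1 2 a * pl b c d)) *
     (pl 1 2 d * pl a b c / (pl a b d * pl 1 2 c))"
proof -
  have ne: "V 1 a \<noteq> V 1 c" "V 1 a \<noteq> V 1 b" "V 1 a \<noteq> V 2 c" "V 2 b \<noteq> V 1 c" "V 2 b \<noteq> V 1 b"
    "V 2 b \<noteq> V 2 c" "V 2 d \<noteq> V 1 c" "V 2 d \<noteq> V 1 b" "V 2 d \<noteq> V 2 c"
    "V 1 d \<noteq> V 1 c" "V 1 d \<noteq> V 1 b" "V 1 d \<noteq> V 2 c" "V 2 c \<noteq> V 1 c" "V 2 c \<noteq> V 1 b"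
    by simp_all
  have y1: "yhat R1 (V 2 c) =
      (pl 1 a b * pl 1 2 c * pl b c d) / (pl 1 c d * pl a b c * pl 1 2 b)"
    unfolding R1_def yhat_mutate_self[OF finite_R(1) two_acyclic_loop[OF two_acyclic_R(1)]]
    unfolding yhat_as_prods R0_prods by simp
  show "yhat R3 (V 1 a) = yhat R0 (V 1 a) * (Q / (pl a c d * pl 1 2 b))"
    unfolding yhat_R3[OF ne(1)] yhat_R2[OF ne(2)] yhat_R1[OF ne(3)] arr_R2_c arr_R1_b arr_R0
    by simp
  show "yhat R3 (V 2 b) = yhat R0 (V 2 b) * (pl 1 c d * pl a b c * pl 1 2 b / (Q * pl 1 b c))"
    unfolding yhat_R3[OF ne(4)] yhat_R2[OF ne(5)] yhat_R1[OF ne(6)] arr_R2_c arr_R1_b arr_R0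
    by simp
  show "yhat R3 (V 2 d) = yhat R0 (V 2 d) * (Q * pl 1 b c / (pl 1 a b * pl 1 2 c * pl b c d))"
    unfolding yhat_R3[OF ne(7)] yhat_R2[OF ne(8)] yhat_R1[OF ne(9)] arr_R2_c arr_R1_b arr_R0
    by simp
  show "yhat R3 (V 1 d) = yhat R0 (V 1 d) * (pl a b d * pl 1 2 c / Q)"
    unfolding yhat_R3[OF ne(10)] yhat_R2[OF ne(11)] yhat_R1[OF ne(12)] arr_R2_c arr_R1_b arr_R0
    by simp
  show "yhat R3 (V 2 c) = (pl 1 a b * pl 1 2 c * pl b c d) / (pl 1 c d * pl a b c * pl 1 2 b) *
     (pl a c d * pl 1 2 b / (pl 1 2 a * pl b c d)) *
     (pl 1 2 d * pl a b c / (pl a b d * pl 1 2 c))"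
    unfolding yhat_R3[OF ne(13)] yhat_R2[OF ne(14)] y1 arr_R2_c arr_R1_b
    by simp
qed

section \<open>Agreement of the exchange ratios\<close>

lemma Q_nonzero: "Q \<noteq> 0"
  using Q_pos pos_set_nonzero by blast

text \<open>The special positions are a - 1, a and b; they correspond to \<open>V 1 a\<close>,
  \<open>V 2 c\<close> and \<open>V 1 d\<close>, the surviving first-row and \<open>Q\<close>
  vertices touched by the mutations.\<close>

lemma promotion_yhat_row1:
  assumes j: "j \<in> {4..n - 3}"
  shows "\<Psi> (yhat \<Sigma> (V 1 j)) = yhat R3 (\<beta> (V 1 j))"
proof -
  have nz: "Q \<noteq> 0" "pl a c d \<noteq> 0" "pl a b d \<noteq> 0" "pl 1 c d \<noteq> 0" "pl 1 2 b \<noteq> 0" "pl 1 2 c \<noteq> 0"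
      "pl b c d \<noteq> 0" "pl a b c \<noteq> 0"
    using Q_nonzero ord by (simp_all add: pl_nonzero)
  have j4: "4 \<le> j" "4 \<le> a" "4 \<le> b" "4 \<le> c" "4 \<le> (4 :: nat)"
    using j ord by auto
  consider "j + 1 < a" | "j + 1 = a" | "j = a" | "j = b" | "c \<le> j"
    using b_def c_def by linarith
  thus ?thesis
  proof cases
    case 1
    have E: "e (j - 1) = j" "e j = j + 1" "e (j + 1) = j + 2"
      using 1 j by (auto simp: e_def b_def c_def d_def)
    have J: "j + 1 \<in> {4..n - 1}" "j + 1 + 1 = j + 2" "j + 1 - 1 = j" "j < a"
      using 1 j ord by auto
    have g: "yhat R3 (V 1 (j + 1)) = yhat R0 (V 1 (j + 1))"
      using 1 ord by (intro yhat_R3_generic) auto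
    show ?thesis
      unfolding promotion_yhat_S[OF j] E \<beta>_simps(1)[OF J(4) j4(1)] g yhat_R0[OF J(1)] J(2,3)
      using 1 j ord by (simp add: promotion_pl_fixed)
  next
    case 2
    have E: "e (j - 1) = j" "e j = a" "e (j + 1) = b"
      using 2 j b_def by (auto simp: e_def b_def c_def d_def)
    have J: "a \<in> {4..n - 1}" "j < a"
      using 2 ord by auto
    have J': "j + 1 = a" "a + 1 = b" "a - 1 = j"
      using 2 b_def by auto
    show ?thesis
      unfolding promotion_yhat_S[OF j] E unfolding \<beta>_simps(1)[OF J(2) j4(1)] J'(1) yhat_R3_special
        yhat_R0[OF J(1)] J'(2,3) promotion_pl_12b
      using 2 j ord nz by (simp add: promotion_pl_fixed mult_ac)
  next
    case 3
    \<comment> \<open>Position a meets the ratio at \<open>V 2 c\<close>. Its three factors cancel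
      to the image found on the left, because \<open>promotion_pl_1bd\<close> has already used the
      Pluecker relation.\<close>
    have E: "e (j - 1) = a" "e j = b" "e (j + 1) = d"
      using 3 a5 by (auto simp: e_def b_def c_def d_def)
    show ?thesis
      unfolding promotion_yhat_S[OF j] E promotion_pl_1bd unfolding 3 \<beta>_simps yhat_R3_special
      using ord nz by (simp add: promotion_pl_fixed mult_ac)
  next
    case 4
    have E: "e (j - 1) = b" "e j = d" "e (j + 1) = d + 1"
      using 4 a5 by (auto simp: e_def b_def c_def d_def)
    have J: "d \<in> {4..n - 1}" "j + 2 = d" "b \<le> j" "d - 1 = c"
      using 4 j ord by (auto simp: b_def c_def d_def)
    show ?thesis
      unfolding promotion_yhat_S[OF j] E promotion_pl_1bd promotion_pl_12b
        \<beta>_simps(3)[OF J(3) j4(1)] J(2) yhat_R3_special yhat_R0[OF J(1)] J(4)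
      using ord nz by (simp add: promotion_pl_fixed)
  next
    case 5
    have E: "e (j - 1) = j + 1" "e j = j + 2" "e (j + 1) = j + 3"
      using 5 a5 by (auto simp: e_def b_def c_def d_def)
    have J: "j + 2 \<in> {4..n - 1}" "j + 2 - 1 = j + 1" "j + 2 + 1 = j + 3" "b \<le> j"
      using 5 j ord by auto
    have g: "yhat R3 (V 1 (j + 2)) = yhat R0 (V 1 (j + 2))"
      using 5 ord by (intro yhat_R3_generic) (auto simp: b_def c_def d_def)
    show ?thesis
      unfolding promotion_yhat_S[OF j] E \<beta>_simps(3)[OF J(4) j4(1)] g yhat_R0[OF J(1)] J(2,3)
      using 5 j ord by (simp add: promotion_pl_fixed)
  qed
qed

text \<open>Positions a and b correspond to \<open>V 2 b\<close> and \<open>V 2 d\<close>, whose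
  ratios change. Positions 4 and c meet unchanged ratios, but their coordinates involve the promoted
  columns 2 and b.\<close>

lemma promotion_yhat_row2:
  assumes j: "j \<in> {4..n - 3}"
  shows "\<Psi> (yhat \<Sigma> (V 2 j)) = yhat R3 (\<beta> (V 2 j))"
proof -
  have nz: "Q \<noteq> 0" "pl a c d \<noteq> 0" "pl a b d \<noteq> 0" "pl 1 c d \<noteq> 0" "pl 1 2 b \<noteq> 0" "pl 1 2 c \<noteq> 0"
      "pl b c d \<noteq> 0" "pl a b c \<noteq> 0" "pl 1 b c \<noteq> 0" "pl 1 2 4 \<noteq> 0"
    using Q_nonzero ord by (simp_all add: pl_nonzero)
  have j4: "4 \<le> j" "4 \<le> a" "4 \<le> b" "4 \<le> c" "4 \<le> (4 :: nat)"
    using j ord by auto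
  consider "j = 4" | "5 \<le> j" "j < a" | "5 \<le> j" "j = a" | "j = b" | "j = c" | "d \<le> j"
    using j b_def c_def d_def a5 by fastforce
  thus ?thesis
  proof cases
    case 1
    have E: "e (4 - 1) = 4" "e 4 = 5" "e (4 + 1) = 6" "e (4 - 2) = 2"
      using a5 by (auto simp: e_def b_def c_def d_def)
    have J: "5 \<in> {4..n - 1}" "(5 :: nat) - 1 = 4" "(5 :: nat) - 2 = 3" "(5 :: nat) + 1 = 6"
        "4 \<le> a" "(4 :: nat) + 1 = 5"
      using ord by auto
    have g: "yhat R3 (V 2 5) = yhat R0 (V 2 5)"
      using ord by (intro yhat_R3_generic) auto
    \<comment> \<open>If a = 5, column 6 is b and is promoted; the coordinates are still fixed
      because they contain a as well.\<close>
    have f: "\<Psi> (pl 1 5 6) = pl 1 5 6" "\<Psi> (pl 4 5 6) = pl 4 5 6"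
    proof (atomize (full), cases "b = 6")
      case True
      hence "a = 5"
        by (simp add: b_def)
      thus "\<Psi> (pl 1 5 6) = pl 1 5 6 \<and> \<Psi> (pl 4 5 6) = pl 4 5 6"
        using promotion_pl_fixed(3)[of 1] promotion_pl_fixed(3)[of 4] True by simp
    next
      case False
      thus "\<Psi> (pl 1 5 6) = pl 1 5 6 \<and> \<Psi> (pl 4 5 6) = pl 4 5 6"
        using ord by (simp add: promotion_pl_fixed)
    qed
    show ?thesis
      unfolding promotion_yhat_S[OF j] unfolding 1 E unfolding \<beta>_simps(4)[OF J(5) j4(5)] J(6) g yhat_R0[OF J(1)]
        J(2-4) promotion_pl_245
      using nz ord by (simp add: f promotion_pl_fixed mult_ac)
  next
    case 2
    have E: "e (j - 2) = j - 1" "e (j - 1) = j" "e j = j + 1" "e (j + 1) = j + 2"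
      using 2 by (auto simp: e_def b_def c_def d_def)
    have J: "j + 1 \<in> {4..n - 1}" "j + 1 + 1 = j + 2" "j + 1 - 1 = j" "j + 1 - 2 = j - 1" "j \<le> a"
      using 2 j ord by auto
    have g: "yhat R3 (V 2 (j + 1)) = yhat R0 (V 2 (j + 1))"
      using 2 ord by (intro yhat_R3_generic) auto
    have f: "\<Psi> (pl i (j + 1) (j + 2)) = pl i (j + 1) (j + 2)" if "i \<noteq> 2" "i \<noteq> b" for i
    proof (cases "j + 2 = b")
      case True
      hence "j + 1 = a"
        by (simp add: b_def)
      thus ?thesis
        unfolding True using promotion_pl_fixed(3)[OF that] by simp
    next
      case False
      thus ?thesis
        using that 2 ord by (simp add: promotion_pl_fixed)
    qed
    have f': "\<Psi> (pl 1 (j + 1) (j + 2)) = pl 1 (j + 1) (j + 2)"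
      "\<Psi> (pl j (j + 1) (j + 2)) = pl j (j + 1) (j + 2)"
      by (rule f; use 2 ord in simp)+
    show ?thesis
      unfolding promotion_yhat_S[OF j] E \<beta>_simps(4)[OF J(5) j4(1)] g yhat_R0[OF J(1)] J(2-4) f'
      using 2 ord by (simp add: promotion_pl_fixed)
  next
    case 3
    have E: "e (a - 2) = a - 1" "e (a - 1) = a" "e a = b" "e (a + 1) = d"
      using a5 by (auto simp: e_def b_def c_def d_def)
    have J: "b \<in> {4..n - 1}" "b + 1 = c" "b - 1 = a" "b - 2 = a - 1" "a \<le> a" "a + 1 = b"
      using ord by (auto simp: b_def c_def)
    show ?thesis
      unfolding promotion_yhat_S[OF j] unfolding 3 E unfolding \<beta>_simps(4)[OF J(5) j4(2)] J(6) yhat_R3_special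
        yhat_R0[OF J(1)] J(2-4) promotion_pl_1bd promotion_pl_12b
      using ord nz by (simp add: promotion_pl_fixed mult_ac)
  next
    case 4
    have E: "e (b - 2) = a" "e (b - 1) = b" "e b = d" "e (b + 1) = d + 1"
      using a5 by (auto simp: e_def b_def c_def d_def)
    have J: "d \<in> {4..n - 1}" "d - 1 = c" "d - 2 = b" "b \<le> b" "b + 2 = d"
      using 4 j ord by (auto simp: b_def c_def d_def)
    have f: "\<Psi> (pl b d (d + 1)) = pl c d (d + 1) * (pl a b d / pl a c d)"
      using ord by (intro promotion_pl_bd) auto
    show ?thesis
      unfolding promotion_yhat_S[OF j] unfolding 4 E unfolding \<beta>_simps(5)[OF J(4) j4(3)] J(5) yhat_R3_special
        yhat_R0[OF J(1)] J(2-3) promotion_pl_12b f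
      using ord nz by (simp add: promotion_pl_fixed)
  next
    case 5
    \<comment> \<open>The images of \<open>pl b d (d + 1)\<close> and \<open>pl 1 b d\<close> carry
      the same factor \<open>pl a b d / pl a c d\<close>, which cancels in the ratio.\<close>
    have E: "e (c - 2) = b" "e (c - 1) = d" "e c = d + 1" "e (c + 1) = d + 2"
      using a5 by (auto simp: e_def b_def c_def d_def)
    have J: "d + 1 \<in> {4..n - 1}" "d + 1 - 1 = d" "d + 1 - 2 = c" "b \<le> c" "c + 2 = d + 1"
        "d + 1 + 1 = d + 2"
      using 5 j ord by (auto simp: b_def c_def d_def)
    have f: "\<Psi> (pl b d (d + 1)) = pl c d (d + 1) * (pl a b d / pl a c d)"
      using ord by (intro promotion_pl_bd) auto
    have g: "yhat R3 (V 2 (d + 1)) = yhat R0 (V 2 (d + 1))"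
      using ord by (intro yhat_R3_generic) auto
    show ?thesis
      unfolding promotion_yhat_S[OF j] unfolding 5 E unfolding \<beta>_simps(5)[OF J(4) j4(4)] J(5) g
        yhat_R0[OF J(1)] J(2,3,6) promotion_pl_1bd f
      using ord nz by (simp add: promotion_pl_fixed mult_ac)
  next
    case 6
    have E: "e (j - 2) = j" "e (j - 1) = j + 1" "e j = j + 2" "e (j + 1) = j + 3"
      using 6 a5 by (auto simp: e_def b_def c_def d_def)
    have J: "j + 2 \<in> {4..n - 1}" "j + 2 - 1 = j + 1" "j + 2 - 2 = j" "j + 2 + 1 = j + 3" "b \<le> j"
      using 6 j ord by auto
    have g: "yhat R3 (V 2 (j + 2)) = yhat R0 (V 2 (j + 2))"
      using 6 ord by (intro yhat_R3_generic) auto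
    show ?thesis
      unfolding promotion_yhat_S[OF j] E \<beta>_simps(5)[OF J(5) j4(1)] g yhat_R0[OF J(1)] J(2-4)
      using 6 j ord by (simp add: promotion_pl_fixed)
  qed
qed

section \<open>Agreement of the quivers on mutable vertices\<close>

lemma e_succ: "3 \<le> j \<Longrightarrow> e i = e j + 1 \<longleftrightarrow> j \<noteq> a \<and> i = j + 1"
  using a5 by (auto simp: e_def)

text \<open>As in \<open>e_succ\<close>, adjacency of columns is lost only between positions a and
  b, whose elements b and d enclose c. The lower bounds keep away from the gap at 3.\<close>

lemma e_pred: "4 \<le> j \<Longrightarrow> 4 \<le> i \<Longrightarrow> e i = e j - 1 \<longleftrightarrow> i \<noteq> a \<and> j = i + 1"
  using a5 by (auto simp: e_def)

lemma e_mem: "4 \<le> j \<Longrightarrow> j \<le> n - 3 \<Longrightarrow> 4 \<le> e j \<and> e j \<le> n - 1"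
  using a5 dn by (auto simp: e_def d_def c_def b_def)

text \<open>The only path through a mutated vertex that joins two of the remaining mutable vertices
  is \<open>V 2 b\<close>, \<open>V 2 c\<close>, \<open>V 2 d\<close>. Its composite arrow bridges
  column c and matches the arrow \<open>V 2 a\<close> to \<open>V 2 b\<close> of the smaller
  seed.\<close>

lemma arr_R3_generic:
  assumes "u \<in> mut R0 - {V 2 c, V 1 b, V 1 c}" "v \<in> mut R0 - {V 2 c, V 1 b, V 1 c}"
  shows "arr R3 u v = arr R0 u v + of_bool (u = V 2 b \<and> v = V 2 d)"
proof -
  have b: "b \<in> {4..card {1..n} - 1}"
    using ord by auto
  have ne3: "u \<noteq> V 3 j" "v \<noteq> V 3 j" for j
    using assms not_row3_mut by blast+
  have anti: "arr T x y - arr T y x = arr T x y" if "two_acyclic T" for T :: "vertex seed" and x y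
    using that unfolding two_acyclic_def by (metis diff_zero zero_diff)
  have bd: "arr R0 (V 2 b) (V 2 d) = 0" "arr R0 (V 2 d) (V 2 b) = 0"
    unfolding arr_rectangles_row2[OF b] using ord by (auto simp: pred)
  have "arr R3 u v = arr R2 u v"
    unfolding R3_def arr_mutate arr_R2_c using assms ne3 by (simp add: anti)
  also have "\<dots> = arr R1 u v"
    unfolding R2_def arr_mutate arr_R1_b using assms ne3 by (simp add: anti)
  also have "\<dots> = arr R0 u v + of_bool (u = V 2 b \<and> v = V 2 d)"
    unfolding R1_def arr_mutate arr_R0(1,2) using assms ne3 anti[of R0 u v] bd
    by (auto simp: of_bool_def)
  finally show ?thesis .
qed

text \<open>These are the images of the neighbours of \<open>V 1 a\<close> in the smaller seed:
  \<open>V 2 b\<close> and \<open>V 1 (a - 1)\<close> come in, \<open>V 2 a\<close> and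
  \<open>V 1 b\<close> go out.\<close>

lemma arr_R3_c:
  assumes "u \<in> mut R0 - {V 2 c, V 1 b, V 1 c}"
  shows "arr R3 u (V 2 c) = of_bool (u \<in> {V 2 d, V 1 a})"
    and "arr R3 (V 2 c) u = of_bool (u \<in> {V 2 b, V 1 d})"
proof -
  have ne3: "u \<noteq> V 3 j" for j
    using assms not_row3_mut by blast
  have u: "u \<noteq> V 2 c" "u \<noteq> V 1 b" "u \<noteq> V 1 c"
    using assms by auto
  have 1: "arr R1 u (V 2 c) = of_bool (u = V 2 d)" "arr R1 (V 2 c) u = of_bool (u = V 2 b)"
    unfolding R1_def arr_mutate arr_R0 using u ne3 by simp_all
  have 2: "arr R2 u (V 2 c) = of_bool (u \<in> {V 2 d, V 1 a})" "arr R2 (V 2 c) u = of_bool (u = V 2 b)"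
    unfolding R2_def arr_mutate 1 arr_R1_b using u ne3 by (simp_all add: of_bool_def)
  show "arr R3 u (V 2 c) = of_bool (u \<in> {V 2 d, V 1 a})"
    "arr R3 (V 2 c) u = of_bool (u \<in> {V 2 b, V 1 d})"
    unfolding R3_def arr_mutate 2 arr_R2_c using u ne3 by (simp_all add: of_bool_def)
qed

lemma \<beta>_range:
  assumes "v \<in> mut \<Sigma>" "v \<noteq> V 1 a"
  shows "\<beta> v \<in> mut R0 - {V 2 c, V 1 b, V 1 c}"
proof -
  have "\<beta> v \<in> mut \<Sigma>'"
    using \<beta>_bij assms(1) by (auto simp: bij_betw_def)
  moreover have "\<beta> v \<noteq> V 2 c"
    using assms
  proof (cases rule: mut_cases)
    case (1 j)
    thus ?thesis
      using assms(2) \<beta>_V(1)[of j] by auto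
  next
    case (2 j)
    thus ?thesis
      using \<beta>_V(3)[of j] e_eq(2)[of j] by simp
  qed
  ultimately show ?thesis
    unfolding mut_\<Sigma>' by blast
qed

text \<open>Arrows at \<open>V 1 a\<close> are compared with those at \<open>V 2 c\<close>. All
  others keep their shape under \<open>e\<close>, except where the skipped column c breaks adjacency
  in row 2.\<close>

lemma arr_\<beta>:
  assumes u: "u \<in> mut \<Sigma>" and v: "v \<in> mut \<Sigma>"
  shows "arr \<Sigma> u v = arr R3 (\<beta> u) (\<beta> v)"
proof -
  have aS: "a \<in> {4..card N' - 1}"
    using ord by auto
  have eb: "e b = d" "e (a - 1) = a"
    using a5 by (auto simp: e_def b_def c_def d_def)
  have vc: "(\<exists>i. v = V 1 i \<and> i \<noteq> a \<and> 4 \<le> i) \<or> (\<exists>i. v = V 2 i \<and> 4 \<le> i) \<or> v = V 1 a"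
    using v by (cases rule: mut_cases) auto
  have uc: "(\<exists>i. u = V 1 i \<and> i \<noteq> a \<and> 4 \<le> i) \<or> (\<exists>i. u = V 2 i \<and> 4 \<le> i) \<or> u = V 1 a"
    using u by (cases rule: mut_cases) auto
  consider "u = V 1 a" "v = V 1 a" | "u = V 1 a" "v \<noteq> V 1 a" | "u \<noteq> V 1 a" "v = V 1 a"
    | "u \<noteq> V 1 a" "v \<noteq> V 1 a"
    by blast
  thus ?thesis
  proof cases
    case 1
    thus ?thesis
      by (simp add: two_acyclic_rectangles \<beta>_V)
  next
    case 2
    have "arr R3 (\<beta> u) (\<beta> v) = of_bool (\<beta> v \<in> {V 2 (e a), V 1 (e b)})"
      unfolding 2(1) \<beta>_V arr_R3_c[OF \<beta>_range[OF v 2(2)]] e_eq eb ..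
    also have "\<beta> v \<in> {V 2 (e a), V 1 (e b)} \<longleftrightarrow> v \<in> {V 1 b, V 2 a}"
      using vc 2(2) by (auto simp: \<beta>_V e_inj simp del: e_simps)
    finally show ?thesis
      unfolding 2(1) arr_rectangles_row1[OF aS] pred by simp
  next
    case 3
    have "arr R3 (\<beta> u) (\<beta> v) = of_bool (\<beta> u \<in> {V 2 (e b), V 1 (e (a - 1))})"
      unfolding 3(2) \<beta>_V arr_R3_c[OF \<beta>_range[OF u 3(1)]] e_eq eb ..
    also have "\<beta> u \<in> {V 2 (e b), V 1 (e (a - 1))} \<longleftrightarrow> u \<in> {V 2 b, V 1 (a - 1)}"
      using uc 3(1) a5 by (auto simp: \<beta>_V e_inj simp del: e_simps)
    finally show ?thesis
      unfolding 3(2) arr_rectangles_row1[OF aS] pred using a5 by simp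
  next
    case 4
    have b: "arr R3 (\<beta> u) (\<beta> v) = arr R0 (\<beta> u) (\<beta> v) + of_bool (\<beta> u = V 2 b \<and> \<beta> v = V 2 d)"
      by (rule arr_R3_generic[OF \<beta>_range[OF u 4(1)] \<beta>_range[OF v 4(2)]])
    show ?thesis
      using u
    proof (cases rule: mut_cases)
      case (1 j)
      have j: "j \<noteq> a" "3 \<le> j" "e j \<noteq> 4"
        using 1 4 by (auto simp: e_def)
      have "e j \<in> {4..card {1..n} - 1}"
        using e_mem[of j] 1(1) by simp
      note r = arr_rectangles_row1(1)[OF this]
      have "v \<in> {V 1 (j + 1), V 2 j} \<longleftrightarrow> \<beta> v \<in> {V 1 (e j + 1), V 2 (e j)}"
        using vc 4(2) by (elim disjE exE conjE) (simp_all add: \<beta>_V e_inj e_succ j del: e_simps)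
      thus ?thesis
        unfolding b unfolding 1(2) \<beta>_V(1)[OF j(1)] r arr_rectangles_row1(1)[OF 1(1)] by simp
    next
      case (2 j)
      have j: "3 \<le> j" "e j \<noteq> 4" "4 \<le> j"
        using 2 by (auto simp: e_def)
      have "e j \<in> {4..card {1..n} - 1}"
        using e_mem[of j] 2(1) by simp
      note r = arr_rectangles_row2(1)[OF this]
      show ?thesis
        unfolding b unfolding 2(2) \<beta>_V r arr_rectangles_row2(1)[OF 2(1)]
        using vc
      proof (elim disjE exE conjE)
        fix i assume i: "v = V 1 i" "i \<noteq> a" "4 \<le> i"
        show "(of_bool (v \<in> {V 2 (j + 1), V 3 j} \<union> (if j = 4 then {} else {V 1 (j - 1)})) :: nat) =
          of_bool (\<beta> v \<in> {V 2 (e j + 1), V 3 (e j)} \<union> (if e j = 4 then {} else {V 1 (e j - 1)})) +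
          of_bool (V 2 (e j) = V 2 b \<and> \<beta> v = V 2 d)"
          unfolding i(1) \<beta>_V(1)[OF i(2)]
          using e_pred[OF j(3) i(3)] i(2,3) j(2,3) by (cases "i + 1 = j") auto
      next
        fix i assume i: "v = V 2 i" "4 \<le> i"
        \<comment> \<open>For j = a and i = b the columns b and d are not adjacent, and the extra
          arrow from \<open>V 2 b\<close> to \<open>V 2 d\<close> takes over; otherwise adjacency is
          preserved.\<close>
        have "e j = b \<and> e i = d \<longleftrightarrow> j = a \<and> i = b"
          using e_inj e_eq eb by metis
        moreover have "e i = e j + 1 \<longleftrightarrow> j \<noteq> a \<and> i = j + 1"
          by (rule e_succ[OF j(1)])
        ultimately show "(of_bool (v \<in> {V 2 (j + 1), V 3 j} \<union> (if j = 4 then {} else {V 1 (j - 1)})) :: nat) =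
          of_bool (\<beta> v \<in> {V 2 (e j + 1), V 3 (e j)} \<union> (if e j = 4 then {} else {V 1 (e j - 1)})) +
          of_bool (V 2 (e j) = V 2 b \<and> \<beta> v = V 2 d)"
          unfolding i(1) \<beta>_V by (cases "j = a") (simp_all add: pred del: e_simps)
      qed (use 4 in simp)
    qed
  qed
qed

section \<open>Images of the variables up to frozen monomials\<close>

lemma frozen_\<Sigma>'_nonzero: "\<forall>v\<in>verts \<Sigma>' - mut \<Sigma>'. var \<Sigma>' v \<noteq> 0"
  unfolding \<Sigma>'_simps using R_pos(3) pos_set_nonzero by blast

lemma frozen_\<Sigma>'_var: "v \<in> verts R0 \<Longrightarrow> v \<notin> mut \<Sigma>' \<Longrightarrow> var R3 v \<in> frozen_monomials \<Sigma>'"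
  using frozen_monomials_var[of \<Sigma>' v] finite_R(1) by (simp del: rectangles_seed_simps)

lemma frozen_\<Sigma>'_pl:
  "pl 1 3 4 \<in> frozen_monomials \<Sigma>'" "pl 1 2 4 \<in> frozen_monomials \<Sigma>'"
  "pl a c d \<in> frozen_monomials \<Sigma>'" "pl a b d \<in> frozen_monomials \<Sigma>'"
  "pl 1 2 n \<in> frozen_monomials \<Sigma>'" "pl 1 (n - 1) n \<in> frozen_monomials \<Sigma>'"
  "j \<in> {4..n} \<Longrightarrow> pl (j - 2) (j - 1) j \<in> frozen_monomials \<Sigma>'"
proof -
  have v: "V 2 4 \<in> verts R0" "V 1 4 \<in> verts R0" "V 1 b \<in> verts R0" "V 1 c \<in> verts R0"
    "V 1 n \<in> verts R0" "V 2 n \<in> verts R0"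
    using ord by auto
  have f: "V 2 4 \<notin> mut \<Sigma>'" "V 1 4 \<notin> mut \<Sigma>'" "V 1 b \<notin> mut \<Sigma>'" "V 1 c \<notin> mut \<Sigma>'"
    "V 1 n \<notin> mut \<Sigma>'" "V 2 n \<notin> mut \<Sigma>'"
    unfolding mut_\<Sigma>' using ord by auto
  show "pl 1 3 4 \<in> frozen_monomials \<Sigma>'" "pl 1 2 4 \<in> frozen_monomials \<Sigma>'"
    "pl a c d \<in> frozen_monomials \<Sigma>'" "pl a b d \<in> frozen_monomials \<Sigma>'"
    "pl 1 2 n \<in> frozen_monomials \<Sigma>'" "pl 1 (n - 1) n \<in> frozen_monomials \<Sigma>'"
    using frozen_\<Sigma>'_var[OF v(1) f(1)] frozen_\<Sigma>'_var[OF v(2) f(2)] frozen_\<Sigma>'_var[OF v(3) f(3)]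
      frozen_\<Sigma>'_var[OF v(4) f(4)] frozen_\<Sigma>'_var[OF v(5) f(5)] frozen_\<Sigma>'_var[OF v(6) f(6)] ord
    by (simp_all add: var_R3)
  assume j: "j \<in> {4..n}"
  have "V 3 j \<in> verts R0" "V 3 j \<notin> mut \<Sigma>'"
    using j not_row3_mut unfolding mut_\<Sigma>' by auto
  from frozen_\<Sigma>'_var[OF this] show "pl (j - 2) (j - 1) j \<in> frozen_monomials \<Sigma>'"
    using j by (simp add: var_R3)
qed

lemmas frozen_\<Sigma>'_mult = frozen_monomials_mult[OF frozen_\<Sigma>'_nonzero]

lemma frozen_\<Sigma>'_divide:
  "x \<in> frozen_monomials \<Sigma>' \<Longrightarrow> y \<in> frozen_monomials \<Sigma>' \<Longrightarrow> x / y \<in> frozen_monomials \<Sigma>'"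
  unfolding divide_inverse by (intro frozen_\<Sigma>'_mult frozen_monomials_inverse)

lemma var_S:
  "rect_var N' V0 = pl 1 2 4"
  "j \<in> {4..n - 2} \<Longrightarrow> rect_var N' (V 1 j) = pl 1 2 (e j)"
  "j \<in> {4..n - 2} \<Longrightarrow> rect_var N' (V 2 j) = pl 1 (e (j - 1)) (e j)"
  "j \<in> {4..n - 2} \<Longrightarrow> rect_var N' (V 3 j) = pl (e (j - 2)) (e (j - 1)) (e j)"
proof -
  have m: "1 \<in> {1..n - 2}" "2 \<in> {1..n - 2}" "3 \<in> {1..n - 2}"
    using ord by auto
  note m = m[THEN nth_elem_N']
  have "e 3 = 4"
    using ord by simp
  thus "rect_var N' V0 = pl 1 2 4"
    unfolding rect_var.simps m by simp
  assume j: "j \<in> {4..n - 2}"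
  hence "j \<in> {1..n - 2}" "j - 1 \<in> {1..n - 2}" "j - 2 \<in> {1..n - 2}"
    by auto
  note e = this[THEN nth_elem_N']
  show "rect_var N' (V 1 j) = pl 1 2 (e j)" "rect_var N' (V 2 j) = pl 1 (e (j - 1)) (e j)"
    "rect_var N' (V 3 j) = pl (e (j - 2)) (e (j - 1)) (e j)"
    unfolding rect_var.simps m e by simp_all
qed

lemma promotion_row2:
  assumes j: "j \<in> {4..n - 2}"
  shows "\<exists>m\<in>frozen_monomials \<Sigma>'. \<Psi> (pl 1 (e (j - 1)) (e j)) = m * pl 1 (e j - 1) (e j)"
proof -
  consider "j < a" | "j = a" | "j = b" | "c \<le> j"
    using b_def c_def by linarith
  thus ?thesis
  proof cases
    case 1
    have E: "e (j - 1) = j" "e j = j + 1" "e j - 1 = j"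
      using 1 j by (auto simp: e_def)
    have "\<Psi> (pl 1 j (j + 1)) = 1 * pl 1 j (j + 1)"
      using promotion_pl_fixed(1)[of 1 j "j + 1"] 1 j ord by simp
    thus ?thesis
      unfolding E(3) unfolding E(1,2) using frozen_monomials_1 by blast
  next
    case 2
    have E: "e (j - 1) = a" "e j = b" "e j - 1 = a"
      using 2 a5 by (auto simp: e_def b_def)
    have "\<Psi> (pl 1 a b) = 1 * pl 1 a b"
      using promotion_pl_fixed(3)[of 1] ord by simp
    thus ?thesis
      unfolding E(3) unfolding E(1,2) using frozen_monomials_1 by blast
  next
    case 3
    have E: "e (j - 1) = b" "e j = d" "e j - 1 = c"
      using 3 a5 by (auto simp: e_def b_def c_def d_def)
    have "\<Psi> (pl 1 b d) = (pl a b d / pl a c d) * pl 1 c d"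
      using promotion_pl_1bd by simp
    thus ?thesis
      unfolding E(3) unfolding E(1,2) using frozen_\<Sigma>'_divide frozen_\<Sigma>'_pl by blast
  next
    case 4
    have E: "e (j - 1) = j + 1" "e j = j + 2" "e j - 1 = j + 1"
      using 4 a5 by (auto simp: e_def b_def c_def)
    have "\<Psi> (pl 1 (j + 1) (j + 2)) = 1 * pl 1 (j + 1) (j + 2)"
      using promotion_pl_fixed(1)[of 1 "j + 1" "j + 2"] 4 j ord by simp
    thus ?thesis
      unfolding E(3) unfolding E(1,2) using frozen_monomials_1 by blast
  qed
qed

text \<open>Consecutive triples of \<open>N'\<close> are consecutive in \<open>{1..n}\<close> unless
  they straddle 3 or c. The three exceptions are 2, 4, 5, then a, b, d, and b, d, d + 1.\<close>

lemma promotion_row3: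
  assumes j: "j \<in> {4..n - 2}"
  shows "\<Psi> (pl (e (j - 2)) (e (j - 1)) (e j)) \<in> frozen_monomials \<Sigma>'"
proof -
  consider "j = 4" | "5 \<le> j" "j < a" | "5 \<le> j" "j = a" | "j = b" | "j = c" | "d \<le> j"
    using j b_def c_def d_def a5 by fastforce
  thus ?thesis
  proof cases
    case 1
    have E: "e (j - 2) = 2" "e (j - 1) = 4" "e j = 5"
      using 1 a5 by (auto simp: e_def)
    have "pl 3 4 5 \<in> frozen_monomials \<Sigma>'"
      using frozen_\<Sigma>'_pl(7)[of 5] ord by simp
    thus ?thesis
      unfolding E promotion_pl_245 by (intro frozen_\<Sigma>'_mult frozen_\<Sigma>'_divide frozen_\<Sigma>'_pl)
  next
    case 2
    have E: "e (j - 2) = j - 1" "e (j - 1) = j" "e j = j + 1"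
      using 2 by (auto simp: e_def)
    have "\<Psi> (pl (j - 1) j (j + 1)) = pl (j - 1) j (j + 1)"
      using 2 ord by (intro promotion_pl_fixed(1)) auto
    thus ?thesis
      unfolding E using frozen_\<Sigma>'_pl(7)[of "j + 1"] 2 ord by (simp add: One_nat_def)
  next
    case 3
    have E: "e (j - 2) = a - 1" "e (j - 1) = a" "e j = b"
      using 3 by (auto simp: e_def b_def)
    have "\<Psi> (pl (a - 1) a b) = pl (a - 1) a b"
      using 3 ord by (intro promotion_pl_fixed(3)) auto
    thus ?thesis
      unfolding E using frozen_\<Sigma>'_pl(7)[of b] ord by (simp add: b_def One_nat_def)
  next
    case 4
    \<comment> \<open>Here the image is \<open>pl a b d\<close>, frozen in the target only because
      it was frozen by hand.\<close>
    have E: "e (j - 2) = a" "e (j - 1) = b" "e j = d"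
      using 4 a5 by (auto simp: e_def b_def c_def d_def)
    have "\<Psi> (pl a b d) = pl a b d"
      using ord by (intro promotion_pl_fixed(4)) auto
    thus ?thesis
      unfolding E using frozen_\<Sigma>'_pl by simp
  next
    case 5
    have E: "e (j - 2) = b" "e (j - 1) = d" "e j = d + 1"
      using 5 a5 by (auto simp: e_def b_def c_def d_def)
    have f: "\<Psi> (pl b d (d + 1)) = pl c d (d + 1) * (pl a b d / pl a c d)"
      using ord by (intro promotion_pl_bd) auto
    have "d + 1 \<in> {4..n}" "d + 1 - 2 = c" "d + 1 - 1 = d"
      using 5 j ord by (auto simp: d_def)
    from frozen_\<Sigma>'_pl(7)[OF this(1), unfolded this(2,3)] show ?thesis
      unfolding E f by (intro frozen_\<Sigma>'_mult frozen_\<Sigma>'_divide frozen_\<Sigma>'_pl)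
  next
    case 6
    have E: "e (j - 2) = j" "e (j - 1) = j + 1" "e j = j + 2"
      using 6 a5 by (auto simp: e_def b_def c_def d_def)
    have "\<Psi> (pl j (j + 1) (j + 2)) = pl j (j + 1) (j + 2)"
      using 6 ord by (intro promotion_pl_fixed(1)) auto
    moreover have "j + 2 \<in> {4..n}" "j + 2 - 2 = j" "j + 2 - 1 = j + 1"
      using j ord by auto
    ultimately show ?thesis
      unfolding E using frozen_\<Sigma>'_pl(7)[of "j + 2"] by (simp only:)
  qed
qed

lemma promotion_var_mutable:
  assumes "v \<in> mut \<Sigma>"
  shows "\<exists>m\<in>frozen_monomials \<Sigma>'. \<Psi> (rect_var N' v) = m * var R3 (\<beta> v)"
  using assms
proof (cases rule: mut_cases)
  case (1 j)
  have j: "j \<in> {4..n - 2}" "e j \<in> {4..n}"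
    using 1(1) e_mem[of j] by auto
  show ?thesis
  proof (cases "j = a")
    case True
    have "\<Psi> (rect_var N' v) = inverse (pl a c d) * Q"
      unfolding 1(2) var_S(2)[OF j(1)] unfolding True e_eq promotion_pl_12b by (simp add: divide_inverse)
    moreover have "var R3 (\<beta> v) = Q"
      unfolding 1(2) True \<beta>_V by (simp add: var_R3)
    ultimately show ?thesis
      using frozen_monomials_inverse frozen_\<Sigma>'_pl by metis
  next
    case False
    have "e j \<noteq> b" "e j \<noteq> c" "e j \<noteq> 2"
      using False e_inj e_eq j by (metis, metis, auto)
    moreover from this have "\<Psi> (rect_var N' v) = pl 1 2 (e j)"
      unfolding 1(2) var_S(2)[OF j(1)] by (intro promotion_pl_fixed)
    ultimately have "\<Psi> (rect_var N' v) = 1 * var R3 (\<beta> v)"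
      unfolding 1(2) \<beta>_V(1)[OF False] using j(2) by (simp add: var_R3)
    thus ?thesis
      using frozen_monomials_1 by blast
  qed
next
  case (2 j)
  have j: "j \<in> {4..n - 2}" "e j \<in> {4..n}"
    using 2(1) e_mem[of j] by auto
  have "var R3 (\<beta> v) = pl 1 (e j - 1) (e j)"
    unfolding 2(2) \<beta>_V using j(2) e_eq(2) by (simp add: var_R3)
  thus ?thesis
    using promotion_row2[OF j(1)] unfolding 2(2) var_S(3)[OF j(1)] by simp
qed

lemma promotion_var_frozen:
  assumes v: "v \<in> verts \<Sigma> - mut \<Sigma>"
  shows "\<Psi> (rect_var N' v) \<in> frozen_monomials \<Sigma>'"
proof -
  have nn: "n - 2 \<in> {4..n - 2}" "e (n - 2) = n"
    using a5 dn by (auto simp: e_def b_def c_def d_def)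
  consider "v = V0" | j where "v = V 3 j" "j \<in> {4..n - 2}" | "v = V 1 (n - 2)" | "v = V 2 (n - 2)"
  proof -
    have "v = V0 \<or> (\<exists>r j. v = V r j \<and> (r = 1 \<or> r = 2 \<or> r = 3) \<and> j \<in> {4..n - 2})"
      using v by auto
    moreover have "j = n - 2" if "v = V 1 j \<or> v = V 2 j" "j \<in> {4..n - 2}" for j
    proof (rule ccontr)
      assume "j \<noteq> n - 2"
      hence "j \<in> {4..card N' - 1}"
        using that(2) by auto
      thus False
        using v that(1) mem_mut[of j N'] by blast
    qed
    ultimately show thesis
      using that by blast
  qed
  thus ?thesis
  proof cases
    case 1
    have "\<Psi> (pl 1 2 4) = pl 1 2 4"
      using ord by (intro promotion_pl_fixed) auto
    thus ?thesis
      unfolding 1 var_S using frozen_\<Sigma>'_pl by simp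
  next
    case 2
    thus ?thesis
      using promotion_row3 var_S(4) by simp
  next
    case 3
    have "\<Psi> (pl 1 2 n) = pl 1 2 n"
      using ord by (intro promotion_pl_fixed) auto
    thus ?thesis
      unfolding 3 var_S(2)[OF nn(1)] nn using frozen_\<Sigma>'_pl by simp
  next
    case 4
    obtain m where "m \<in> frozen_monomials \<Sigma>'" "\<Psi> (pl 1 (e (n - 2 - 1)) n) = m * pl 1 (n - 1) n"
      using promotion_row2[OF nn(1)] unfolding nn by blast
    thus ?thesis
      unfolding 4 var_S(3)[OF nn(1)] nn using frozen_\<Sigma>'_mult frozen_\<Sigma>'_pl by simp
  qed
qed

lemma promotion_yhat:
  assumes "v \<in> mut \<Sigma>"
  shows "\<Psi> (yhat \<Sigma> v) = yhat R3 (\<beta> v)"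
  using assms
proof (cases rule: mut_cases)
  case (1 j)
  thus ?thesis
    using promotion_yhat_row1[of j] by simp
next
  case (2 j)
  thus ?thesis
    using promotion_yhat_row2[of j] by simp
qed

lemma quasi_pair_S_\<Sigma>': "quasi_pair \<beta> \<Sigma> \<Sigma>'"
  unfolding quasi_pair_def
proof (intro conjI ballI)
  show "finite (verts \<Sigma>)"
    by (rule finite_rectangles_verts)
  show "finite (verts \<Sigma>')"
    using finite_R(1) unfolding \<Sigma>'_simps .
  show "mut \<Sigma> \<subseteq> verts \<Sigma>"
    by auto
  show "mut \<Sigma>' \<subseteq> verts \<Sigma>'"
    unfolding mut_\<Sigma>' \<Sigma>'_simps by auto
  show "two_acyclic \<Sigma>"
    by (rule two_acyclic_rectangles)
  show "two_acyclic \<Sigma>'"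
    using two_acyclic_R(4) unfolding two_acyclic_def \<Sigma>'_simps .
  show "bij_betw \<beta> (mut \<Sigma>) (mut \<Sigma>')"
    by (rule \<beta>_bij)
qed (use S_pos frozen_\<Sigma>'_nonzero promotion_var_frozen promotion_var_mutable promotion_yhat arr_\<beta>
    in \<open>simp_all del: rectangles_seed_simps(1,2,4)\<close>)

lemma quasi_cluster_hom_promotion: "quasi_cluster_hom \<Psi> \<Sigma> \<Sigma>'"
  using quasi_cluster_homI[OF quasi_pair_S_\<Sigma>'] .

end

theorem theorem8p19:
  fixes n a b c d :: nat
  assumes "5 \<le> a" and "b = a + 1" and "c = b + 1" and "d = c + 1" and "d \<le> n"
  shows
    "alg_hom_on (forest_promotion a b c d) (gr_field ({1..n} - {3, c})) (gr_field {1..n}) \<and>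
     quasi_cluster_hom (forest_promotion a b c d)
       (rectangles_seed ({1..n} - {3, c}))
       (freeze {pl 1 3 4, pl 1 2 4, pl a c d, pl a b d}
         (mutate_at (pl 1 2 c) (mutate_at (pl 1 2 b) (mutate_at (pl 1 b c)
           (rectangles_seed {1..n})))))"
proof -
  interpret forest n a b c d
    using assms by unfold_locales
  show ?thesis
    using alg_hom_on_promotion quasi_cluster_hom_promotion
    unfolding R1_eq R2_eq R3_eq \<Sigma>'_def by blast
qed

end
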